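(* If $(e^{tA})_{t\ge0}$ is a uniformly asymptotically positive $C_0$-semigroup on a complex Banach lattice $E$, then the peripheral spectrum of $A$ is cyclic, i.e., if $\beta\in\mathbb R$ and $s(A)+i\beta\in\sigma(A)$, then $s(A)+in\beta\in\sigma(A)$ for all $n\in\mathbb Z$.
   Context: $s(A):=\sup\{\operatorname{Re}\lambda:\lambda\in\sigma(A)\}$ is the spectral bound; the peripheral spectrum is $\{\lambda\in\sigma(A):\operatorname{Re}\lambda=s(A)\}$. A $C_0$-semigroup $(e^{tA})_{t\ge0}$ on a Banach lattice $E$ with positive cone $E_+$ and $s(A)=0$ is uniformly asymptotically positive if it is bounded and for each $\epsilon>0$ there is $t_0\ge0$ such that $\operatorname{dist}(e^{tA}f,E_+)\le\epsilon\|f\|$ for all $t\ge t_0$ and all $0\le f\in E$. If $s(A)\ne-\infty$ is different from $0$, the semigroup is called uniformly asymptotically positive if the rescaled semigroup $(e^{t(A-s(A))})_{t\ge0}$ is. (In particular $s(A)>-\infty$.) *)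

theory Defs
  imports "HOL-Analysis.Analysis" "HOL-Library.Lattice_Algebras"
begin

class banach_lattice = banach + ordered_real_vector + lattice_ab_group_add_abs +
  assumes norm_mono_abs: "\<bar>x\<bar> \<le> \<bar>y\<bar> \<Longrightarrow> norm x \<le> norm y"

lemma norm_abs_eq [simp]: "norm \<bar>x\<bar> = norm (x :: 'a :: banach_lattice)"
  by (intro antisym norm_mono_abs) simp_all

lemma norm_le_if_abs_le: "\<bar>x\<bar> \<le> y \<Longrightarrow> norm x \<le> norm (y :: 'a :: banach_lattice)"
  by (rule norm_mono_abs) (meson abs_ge_self order_trans)

lemma scaleR_le_abs: "c *\<^sub>R x \<le> \<bar>c\<bar> *\<^sub>R \<bar>x :: 'a :: banach_lattice\<bar>"
proof (cases "0 \<le> c")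
  case True
  then show ?thesis by (simp add: scaleR_left_mono abs_ge_self)
next
  case False
  then have "(- c) *\<^sub>R (- x) \<le> (- c) *\<^sub>R \<bar>x\<bar>"
    by (intro scaleR_left_mono abs_ge_minus_self) simp
  with False show ?thesis by simp
qed

lemma tendsto_nonneg_banach_lattice:
  fixes X :: "nat \<Rightarrow> 'a :: banach_lattice"
  assumes "X \<longlonglongrightarrow> L" and "\<And>n. 0 \<le> X n"
  shows "0 \<le> L"
proof -
  have "norm (sup (- L) 0) \<le> norm (X n - L)" for n
  proof -
    have "- L \<le> X n - L" using assms(2)[of n] by simp
    also have "\<dots> \<le> \<bar>X n - L\<bar>" by (rule abs_ge_self)
    finally have "sup (- L) 0 \<le> \<bar>X n - L\<bar>" by simp
    moreover have "\<bar>sup (- L) 0\<bar> = sup (- L) 0" by (rule abs_of_nonneg) simp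
    ultimately show ?thesis by (metis norm_mono_abs)
  qed
  moreover have "(\<lambda>n. norm (X n - L)) \<longlonglongrightarrow> 0"
    using assms(1) by (simp add: LIM_zero tendsto_norm_zero)
  ultimately have "norm (sup (- L) 0) \<le> 0"
    by (meson LIMSEQ_le_const)
  then have "sup (- L) 0 = 0" by simp
  then have "- L \<le> 0" by (metis sup_ge1)
  then show ?thesis by simp
qed

lemma tendsto_le_banach_lattice:
  fixes X Y :: "nat \<Rightarrow> 'a :: banach_lattice"
  assumes "X \<longlonglongrightarrow> K" "Y \<longlonglongrightarrow> L" and "\<And>n. X n \<le> Y n"
  shows "K \<le> L"
  using tendsto_nonneg_banach_lattice[OF tendsto_diff[OF assms(2,1)]] assms(3) by simp


text \<open>
  A complex Banach lattice is the complexification of a real Banach lattice, normed by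
  \<open>\<parallel>z\<parallel> = \<parallel> |z| \<parallel>\<close>, where \<open>|z| = sup {Re (e\<^bsup>i\<theta>\<^esup> z) | \<theta> \<in> \<real>}\<close>.
\<close>

datatype 'a complexification = Cx (real_part: 'a) (imag_part: 'a)

lemma complexification_eqI:
  "real_part z = real_part w \<Longrightarrow> imag_part z = imag_part w \<Longrightarrow> z = w"
  by (rule complexification.expand) simp

instantiation complexification :: (ab_group_add) ab_group_add
begin

definition "0 = Cx 0 0"
definition "z + w = Cx (real_part z + real_part w) (imag_part z + imag_part w)"
definition "- z = Cx (- real_part z) (- imag_part z)"
definition "z - w = Cx (real_part z - real_part w) (imag_part z - imag_part w)"

instance
  by standard
    (simp_all add: zero_complexification_def plus_complexification_def
      uminus_complexification_def minus_complexification_def algebra_simps)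

end

lemma complexification_parts [simp]:
  "real_part 0 = 0" "imag_part 0 = 0"
  "real_part (z + w) = real_part z + real_part w"
  "imag_part (z + w) = imag_part z + imag_part w"
  "real_part (- z) = - real_part z" "imag_part (- z) = - imag_part z"
  "real_part (z - w) = real_part z - real_part w"
  "imag_part (z - w) = imag_part z - imag_part w"
  by (simp_all add: zero_complexification_def plus_complexification_def
      uminus_complexification_def minus_complexification_def)

instantiation complexification :: (real_vector) real_vector
begin

definition "r *\<^sub>R z = Cx (r *\<^sub>R real_part z) (r *\<^sub>R imag_part z)"

instance
  by standard (auto intro!: complexification_eqI simp: scaleR_complexification_def algebra_simps)

end

lemma complexification_parts_scaleR [simp]:
  "real_part (r *\<^sub>R z) = r *\<^sub>R real_part z" "imag_part (r *\<^sub>R z) = r *\<^sub>R imag_part z"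
  by (simp_all add: scaleR_complexification_def)

definition scaleC :: "complex \<Rightarrow> 'a :: real_vector complexification \<Rightarrow> 'a complexification"
    (infixr \<open>*\<^sub>C\<close> 75)
  where "c *\<^sub>C z = Cx (Re c *\<^sub>R real_part z - Im c *\<^sub>R imag_part z)
                    (Re c *\<^sub>R imag_part z + Im c *\<^sub>R real_part z)"

lemma scaleC_parts [simp]:
  "real_part (c *\<^sub>C z) = Re c *\<^sub>R real_part z - Im c *\<^sub>R imag_part z"
  "imag_part (c *\<^sub>C z) = Re c *\<^sub>R imag_part z + Im c *\<^sub>R real_part z"
  by (simp_all add: scaleC_def)

lemma scaleC_scaleC: "a *\<^sub>C (b *\<^sub>C z) = (a * b) *\<^sub>C z"
  by (rule complexification_eqI) (simp_all add: algebra_simps)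

lemma scaleC_one [simp]: "1 *\<^sub>C z = z"
  by (rule complexification_eqI) simp_all

lemma scaleC_add_right: "a *\<^sub>C (z + w) = a *\<^sub>C z + a *\<^sub>C w"
  by (rule complexification_eqI) (simp_all add: algebra_simps)

lemma scaleC_add_left: "(a + b) *\<^sub>C z = a *\<^sub>C z + b *\<^sub>C z"
  by (rule complexification_eqI) (simp_all add: algebra_simps)

lemma scaleC_of_real [simp]: "complex_of_real r *\<^sub>C z = r *\<^sub>R z"
  by (rule complexification_eqI) simp_all

lemma vector_space_scaleC: "vector_space scaleC"
  by unfold_locales (simp_all add: scaleC_scaleC scaleC_add_right scaleC_add_left)

definition is_modulus :: "'a :: banach_lattice complexification \<Rightarrow> 'a \<Rightarrow> bool"
  where "is_modulus z m \<longleftrightarrow>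
    (\<forall>\<theta>. real_part (cis \<theta> *\<^sub>C z) \<le> m) \<and> (\<forall>u. (\<forall>\<theta>. real_part (cis \<theta> *\<^sub>C z) \<le> u) \<longrightarrow> m \<le> u)"

definition modulus :: "'a :: banach_lattice complexification \<Rightarrow> 'a"
  where "modulus z = (THE m. is_modulus z m)"

lemma real_part_cis_lipschitz:
  fixes z :: "'a :: banach_lattice complexification"
  shows "real_part (cis \<theta> *\<^sub>C z)
    \<le> real_part (cis \<phi> *\<^sub>C z) + \<bar>\<theta> - \<phi>\<bar> *\<^sub>R (\<bar>real_part z\<bar> + \<bar>imag_part z\<bar>)"
proof -
  have half: "\<bar>2 * (a * sin (t / 2))\<bar> \<le> \<bar>t\<bar>" if "\<bar>a\<bar> \<le> 1" for a t :: real
  proof -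
    have "\<bar>a\<bar> * \<bar>sin (t / 2)\<bar> \<le> 1 * \<bar>t / 2\<bar>"
      using that by (intro mult_mono abs_sin_x_le_abs_x) auto
    then show ?thesis by (simp add: abs_mult)
  qed
  have c: "\<bar>cos \<theta> - cos \<phi>\<bar> \<le> \<bar>\<theta> - \<phi>\<bar>"
    using half[of "sin ((\<theta> + \<phi>) / 2)" "\<phi> - \<theta>"]
    by (simp add: cos_diff_cos abs_minus_commute mult.assoc)
  have s: "\<bar>sin \<phi> - sin \<theta>\<bar> \<le> \<bar>\<theta> - \<phi>\<bar>"
    using half[of "cos ((\<phi> + \<theta>) / 2)" "\<phi> - \<theta>"]
    by (simp add: sin_diff_sin abs_minus_commute mult.assoc mult.commute)
  have bound: "d *\<^sub>R x \<le> e *\<^sub>R \<bar>x\<bar>" if "\<bar>d\<bar> \<le> e" for d e and x :: 'a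
    using scaleR_le_abs[of d x] scaleR_right_mono[OF that, of "\<bar>x\<bar>"] by simp
  have "real_part (cis \<theta> *\<^sub>C z) - real_part (cis \<phi> *\<^sub>C z)
      = (cos \<theta> - cos \<phi>) *\<^sub>R real_part z + (sin \<phi> - sin \<theta>) *\<^sub>R imag_part z"
    by (simp add: algebra_simps)
  also have "\<dots> \<le> \<bar>\<theta> - \<phi>\<bar> *\<^sub>R \<bar>real_part z\<bar> + \<bar>\<theta> - \<phi>\<bar> *\<^sub>R \<bar>imag_part z\<bar>"
    by (intro add_mono bound c s)
  finally show ?thesis by (simp add: algebra_simps)
qed

text \<open>The supremum exists although the lattice need not be Dedekind complete: it is the norm
  limit of the suprema over finite grids of angles.\<close>

lemma is_modulus_exists: "\<exists>m. is_modulus z m"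
proof -
  define r where "r \<theta> = real_part (cis \<theta> *\<^sub>C z)" for \<theta>
  define K where "K = \<bar>real_part z\<bar> + \<bar>imag_part z\<bar>"
  have K: "0 \<le> K" by (simp add: K_def)
  define \<delta> where "\<delta> n = inverse (real (Suc n))" for n
  define G where "G n = (\<lambda>j. real j * \<delta> n) ` {.. 8 * Suc n}" for n
  define s where "s n = Sup_fin (r ` G n)" for n
  have fin: "finite (r ` G n)" "r ` G n \<noteq> {}" for n by (auto simp: G_def)
  have \<delta>_pos: "0 < \<delta> n" for n by (simp add: \<delta>_def)
  have upper: "r \<theta> \<le> s n + \<delta> n *\<^sub>R K" for \<theta> n
  proof -
    obtain t where t: "0 \<le> t" "t < 2 * pi" "cos \<theta> = cos t" "sin \<theta> = sin t"
      using sincos_total_2pi[of "cos \<theta>" "sin \<theta>"] sin_cos_squared_add2 by metis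
    have t8: "t \<le> 8" using t(2) pi_less_4 by simp
    define j where "j = nat \<lfloor>t * real (Suc n)\<rfloor>"
    have jr: "real j = of_int \<lfloor>t * real (Suc n)\<rfloor>" using t(1) by (simp add: j_def)
    have j1: "real j \<le> t * real (Suc n)" and j2: "t * real (Suc n) < real j + 1"
      unfolding jr by linarith+
    have "real j \<le> 8 * real (Suc n)"
      using j1 mult_right_mono[OF t8, of "real (Suc n)"] by linarith
    then have "j \<le> 8 * Suc n" by linarith
    then have jG: "r (real j * \<delta> n) \<in> r ` G n" by (auto simp: G_def)
    have "\<bar>t * real (Suc n) - real j\<bar> * \<delta> n \<le> 1 * \<delta> n"
      using j1 j2 \<delta>_pos[of n] by (intro mult_right_mono) linarith+
    moreover have "\<bar>t - real j * \<delta> n\<bar> = \<bar>t * real (Suc n) - real j\<bar> * \<delta> n"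
    proof -
      have "t - real j * \<delta> n = (t * real (Suc n) - real j) * \<delta> n"
        by (simp add: \<delta>_def field_simps)
      then show ?thesis by (metis abs_mult abs_of_pos \<delta>_pos)
    qed
    ultimately have d: "\<bar>t - real j * \<delta> n\<bar> \<le> \<delta> n" by simp
    have "r \<theta> = r t" using t by (simp add: r_def)
    also have "\<dots> \<le> r (real j * \<delta> n) + \<bar>t - real j * \<delta> n\<bar> *\<^sub>R K"
      unfolding r_def K_def by (rule real_part_cis_lipschitz)
    also have "\<dots> \<le> s n + \<delta> n *\<^sub>R K"
      unfolding s_def using d K jG fin
      by (intro add_mono scaleR_right_mono Sup_fin.coboundedI) auto
    finally show ?thesis .
  qed
  have least: "s n \<le> u" if "\<And>\<theta>. r \<theta> \<le> u" for n u
    unfolding s_def using fin that by (intro Sup_fin.boundedI) auto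
  have cross: "s m \<le> s n + \<delta> n *\<^sub>R K" for m n by (rule least) (rule upper)
  have dist: "norm (s m - s n) \<le> (\<delta> m + \<delta> n) * norm K" for m n
  proof -
    have nn: "0 \<le> \<delta> k *\<^sub>R K" for k using K \<delta>_pos[of k] by (simp add: scaleR_nonneg_nonneg)
    have "s m - s n \<le> (\<delta> m + \<delta> n) *\<^sub>R K"
      using add_increasing2[OF nn[of m] cross[of m n]]
      by (simp add: algebra_simps diff_le_eq)
    moreover have "- (s m - s n) \<le> (\<delta> m + \<delta> n) *\<^sub>R K"
      using add_increasing2[OF nn[of n] cross[of n m]]
      by (simp add: algebra_simps diff_le_eq)
    ultimately have "\<bar>s m - s n\<bar> \<le> (\<delta> m + \<delta> n) *\<^sub>R K" by (rule abs_leI)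
    from norm_le_if_abs_le[OF this] show ?thesis using \<delta>_pos[of m] \<delta>_pos[of n] by simp
  qed
  have \<delta>_lim: "\<delta> \<longlonglongrightarrow> 0" unfolding \<delta>_def by (rule LIMSEQ_inverse_real_of_nat)
  have "Cauchy s"
  proof (rule metric_CauchyI)
    fix e :: real assume e: "0 < e"
    have "0 < e / (2 * (norm K + 1))" using e by (simp add: add_nonneg_pos)
    from order_tendstoD(2)[OF \<delta>_lim this] obtain M where
      M: "\<And>n. n \<ge> M \<Longrightarrow> \<delta> n < e / (2 * (norm K + 1))"
      by (auto simp: eventually_sequentially)
    have "dist (s m) (s n) < e" if "m \<ge> M" "n \<ge> M" for m n
    proof -
      have pos: "norm K + 1 > 0" by (simp add: add_nonneg_pos)
      have "(\<delta> m + \<delta> n) * norm K \<le> (\<delta> m + \<delta> n) * (norm K + 1)"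
        using \<delta>_pos[of m] \<delta>_pos[of n] by (intro mult_left_mono) auto
      also have "\<dots> < (e / (2 * (norm K + 1)) + e / (2 * (norm K + 1))) * (norm K + 1)"
        using M[OF that(1)] M[OF that(2)] pos by (intro mult_strict_right_mono add_strict_mono)
      also have "\<dots> = e"
      proof -
        have "(e / (2 * k) + e / (2 * k)) * k = e" if "0 < k" for k using that by (simp add: field_simps)
        from this[OF pos] show ?thesis .
      qed
      finally show ?thesis using dist[of m n] by (simp add: dist_norm)
    qed
    then show "\<exists>M. \<forall>m\<ge>M. \<forall>n\<ge>M. dist (s m) (s n) < e" by blast
  qed
  then obtain L where L: "s \<longlonglongrightarrow> L" using Cauchy_convergent_iff convergent_def by blast
  have "(\<lambda>n. s n + \<delta> n *\<^sub>R K) \<longlonglongrightarrow> L + 0 *\<^sub>R K"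
    by (intro tendsto_intros L \<delta>_lim)
  then have "r \<theta> \<le> L" for \<theta>
    using tendsto_le_banach_lattice[OF tendsto_const _ upper] by simp
  moreover have "L \<le> u" if "\<And>\<theta>. r \<theta> \<le> u" for u
    using tendsto_le_banach_lattice[OF L tendsto_const least[OF that]] by blast
  ultimately show ?thesis unfolding is_modulus_def r_def by blast
qed

lemma is_modulus_modulus: "is_modulus z (modulus z)"
  unfolding modulus_def
proof (rule theI')
  show "\<exists>!m. is_modulus z m"
    using is_modulus_exists[of z] by (auto simp: is_modulus_def intro: order.antisym)
qed

lemma modulus_upper: "real_part (cis \<theta> *\<^sub>C z) \<le> modulus z"
  using is_modulus_modulus[of z] by (simp only: is_modulus_def)

lemma modulus_least: "(\<And>\<theta>. real_part (cis \<theta> *\<^sub>C z) \<le> u) \<Longrightarrow> modulus z \<le> u"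
  using is_modulus_modulus[of z] unfolding is_modulus_def by blast

lemma abs_real_part_le_modulus: "\<bar>real_part z\<bar> \<le> modulus z"
  using modulus_upper[of 0 z] modulus_upper[of pi z] by (intro abs_leI) simp_all

lemma abs_imag_part_le_modulus: "\<bar>imag_part z\<bar> \<le> modulus z"
  using modulus_upper[of "- (pi / 2)" z] modulus_upper[of "pi / 2" z] by (intro abs_leI) simp_all

lemma modulus_nonneg [simp]: "0 \<le> modulus z"
  using abs_real_part_le_modulus order_trans abs_ge_zero by blast

lemma modulus_le: "modulus z \<le> \<bar>real_part z\<bar> + \<bar>imag_part z\<bar>"
proof (rule modulus_least)
  fix \<theta>
  have bound: "d *\<^sub>R x \<le> \<bar>x\<bar>" if "\<bar>d\<bar> \<le> 1" for d and x :: 'a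
    using scaleR_le_abs[of d x] scaleR_right_mono[OF that, of "\<bar>x\<bar>"] by simp
  have "real_part (cis \<theta> *\<^sub>C z) = cos \<theta> *\<^sub>R real_part z + (- sin \<theta>) *\<^sub>R imag_part z" by simp
  also have "\<dots> \<le> \<bar>real_part z\<bar> + \<bar>imag_part z\<bar>" by (intro add_mono bound) simp_all
  finally show "real_part (cis \<theta> *\<^sub>C z) \<le> \<bar>real_part z\<bar> + \<bar>imag_part z\<bar>" .
qed

lemma modulus_triangle: "modulus (z + w) \<le> modulus z + modulus w"
proof (rule modulus_least)
  fix \<theta>
  show "real_part (cis \<theta> *\<^sub>C (z + w)) \<le> modulus z + modulus w"
    using add_mono[OF modulus_upper[of \<theta> z] modulus_upper[of \<theta> w]]
    by (simp only: scaleC_add_right complexification_parts)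
qed

lemma modulus_scaleC_le: "modulus (c *\<^sub>C z) \<le> cmod c *\<^sub>R modulus z"
proof (rule modulus_least)
  fix \<theta>
  have "cis \<theta> * c = of_real (cmod c) * cis (\<theta> + Arg c)"
    by (metis cis_mult mult.left_commute rcis_cmod_Arg rcis_def)
  then have "cis \<theta> *\<^sub>C (c *\<^sub>C z) = cmod c *\<^sub>R (cis (\<theta> + Arg c) *\<^sub>C z)"
    by (metis scaleC_scaleC scaleC_of_real)
  then have "real_part (cis \<theta> *\<^sub>C (c *\<^sub>C z)) = cmod c *\<^sub>R real_part (cis (\<theta> + Arg c) *\<^sub>C z)"
    by (simp only: complexification_parts_scaleR)
  also have "\<dots> \<le> cmod c *\<^sub>R modulus z"
    by (intro scaleR_left_mono modulus_upper) simp
  finally show "real_part (cis \<theta> *\<^sub>C (c *\<^sub>C z)) \<le> cmod c *\<^sub>R modulus z" .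
qed

lemma modulus_0 [simp]: "modulus 0 = 0"
  using modulus_le[of 0] by (intro order.antisym) simp_all

lemma modulus_scaleC: "modulus (c *\<^sub>C z) = cmod c *\<^sub>R modulus z"
proof (cases "c = 0")
  case True
  then have "c *\<^sub>C z = 0" by (intro complexification_eqI) simp_all
  with True show ?thesis by simp
next
  case False
  have "modulus (inverse c *\<^sub>C (c *\<^sub>C z)) \<le> cmod (inverse c) *\<^sub>R modulus (c *\<^sub>C z)"
    by (rule modulus_scaleC_le)
  then have "modulus z \<le> inverse (cmod c) *\<^sub>R modulus (c *\<^sub>C z)"
    using False by (simp add: scaleC_scaleC norm_inverse)
  from scaleR_left_mono[OF this, of "cmod c"] have "cmod c *\<^sub>R modulus z \<le> modulus (c *\<^sub>C z)"
    using False by simp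
  with modulus_scaleC_le show ?thesis by (rule order.antisym)
qed

instantiation complexification :: (banach_lattice) real_normed_vector
begin

definition norm_complexification_def: "norm z = norm (modulus z)"

definition sgn_complexification_def: "sgn (z :: 'a complexification) = z /\<^sub>R norm z"

definition dist_complexification_def: "dist (z :: 'a complexification) w = norm (z - w)"

definition uniformity_complexification_def:
  "(uniformity :: ('a complexification \<times> 'a complexification) filter)
    = (INF e\<in>{0 <..}. principal {(x, y). dist x y < e})"

definition open_complexification_def:
  "open (U :: 'a complexification set)
    \<longleftrightarrow> (\<forall>x\<in>U. eventually (\<lambda>(x', y). x' = x \<longrightarrow> y \<in> U) uniformity)"

instance
proof
  fix r :: real and z w :: "'a complexification"
  show "norm z = 0 \<longleftrightarrow> z = 0"
  proof
    assume "norm z = 0"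
    then have "modulus z = 0" by (simp add: norm_complexification_def)
    with abs_real_part_le_modulus[of z] abs_imag_part_le_modulus[of z]
    have "\<bar>real_part z\<bar> = 0" "\<bar>imag_part z\<bar> = 0" by (auto intro: order.antisym)
    then show "z = 0" by (intro complexification_eqI) simp_all
  qed (simp add: norm_complexification_def)
  have "norm (modulus (z + w)) \<le> norm (modulus z + modulus w)"
    by (rule norm_le_if_abs_le) (simp add: modulus_triangle)
  then show "norm (z + w) \<le> norm z + norm w"
    using norm_triangle_ineq order_trans unfolding norm_complexification_def by blast
  show "norm (r *\<^sub>R z) = \<bar>r\<bar> * norm z"
    using modulus_scaleC[of "of_real r" z] by (simp add: norm_complexification_def)
qed (rule sgn_complexification_def dist_complexification_def open_complexification_def
       uniformity_complexification_def)+

end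

instance complexification :: (banach_lattice) banach
proof
  fix X :: "nat \<Rightarrow> 'a complexification"
  assume X: "Cauchy X"
  have dist_eq: "dist a b = norm (modulus (a - b))" for a b :: "'a complexification"
    by (simp add: dist_complexification_def norm_complexification_def)
  have re: "dist (real_part a) (real_part b) \<le> dist a b"
    and im: "dist (imag_part a) (imag_part b) \<le> dist a b" for a b :: "'a complexification"
    unfolding dist_eq unfolding dist_norm
    using abs_real_part_le_modulus[of "a - b"] abs_imag_part_le_modulus[of "a - b"]
    by (auto intro: norm_le_if_abs_le)
  have "Cauchy (\<lambda>n. real_part (X n))" "Cauchy (\<lambda>n. imag_part (X n))"
    using X re im unfolding Cauchy_def by (meson le_less_trans)+
  then obtain a b where ab: "(\<lambda>n. real_part (X n)) \<longlonglongrightarrow> a" "(\<lambda>n. imag_part (X n)) \<longlonglongrightarrow> b"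
    using Cauchy_convergent_iff convergent_def by metis
  have "dist (X n) (Cx a b) \<le> norm (real_part (X n) - a) + norm (imag_part (X n) - b)" for n
  proof -
    have "norm (modulus (X n - Cx a b))
        \<le> norm (\<bar>real_part (X n) - a\<bar> + \<bar>imag_part (X n) - b\<bar>)"
      using modulus_le[of "X n - Cx a b"] by (intro norm_le_if_abs_le) simp
    also have "\<dots> \<le> norm (real_part (X n) - a) + norm (imag_part (X n) - b)"
      using norm_triangle_ineq[of "\<bar>real_part (X n) - a\<bar>" "\<bar>imag_part (X n) - b\<bar>"] by simp
    finally show ?thesis by (simp add: dist_eq)
  qed
  note dist_le = this
  have "(\<lambda>n. norm (real_part (X n) - a) + norm (imag_part (X n) - b)) \<longlonglongrightarrow> 0 + 0"
    using ab by (intro tendsto_add tendsto_norm_zero) (simp_all add: LIM_zero)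
  then have "(\<lambda>n. norm (real_part (X n) - a) + norm (imag_part (X n) - b)) \<longlonglongrightarrow> 0"
    by simp
  then have "(\<lambda>n. dist (X n) (Cx a b)) \<longlonglongrightarrow> 0"
    by (rule Lim_null_comparison[rotated]) (simp add: dist_le)
  then show "convergent X"
    unfolding convergent_def by (intro exI[of _ "Cx a b"]) (simp add: tendsto_dist_iff[of X "Cx a b"])
qed

lemma norm_scaleC: "norm (c *\<^sub>C z) = cmod c * norm z"
  by (simp add: norm_complexification_def modulus_scaleC)

lemma norm_real_Cx [simp]: "norm (Cx x 0) = norm x"
proof -
  have "modulus (Cx x 0) = \<bar>x\<bar>"
    using modulus_le[of "Cx x 0"] abs_real_part_le_modulus[of "Cx x 0"]
    by (intro order.antisym) simp_all
  then show ?thesis by (simp add: norm_complexification_def)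
qed

definition positive_cone :: "'a :: banach_lattice complexification set"
  where "positive_cone = {Cx x 0 | x. 0 \<le> x}"


text \<open>An operator is a pair of its domain and a map whose values matter only on the domain.\<close>

type_synonym 'e operator = "'e set \<times> ('e \<Rightarrow> 'e)"

fun resolvent_set :: "'a :: banach_lattice complexification operator \<Rightarrow> complex set"
  where "resolvent_set (D, A) =
    {\<mu>. bij_betw (\<lambda>f. \<mu> *\<^sub>C f - A f) D UNIV \<and> bounded_linear (inv_into D (\<lambda>f. \<mu> *\<^sub>C f - A f))}"

definition spectrum :: "'a :: banach_lattice complexification operator \<Rightarrow> complex set"
  where "spectrum A = - resolvent_set A"

text \<open>With values in \<^typ>\<open>ereal\<close>, the spectral bound of an operator with empty spectrum is \<open>-\<infinity>\<close>.\<close>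

definition spectral_bound :: "'a :: banach_lattice complexification operator \<Rightarrow> ereal"
  where "spectral_bound A = (SUP \<mu>\<in>spectrum A. ereal (Re \<mu>))"


text \<open>Only the values of \<open>T\<close> at times \<open>t \<ge> 0\<close> are relevant.\<close>

definition c0_semigroup ::
    "(real \<Rightarrow> 'a :: banach_lattice complexification \<Rightarrow> 'a complexification) \<Rightarrow> bool"
  where "c0_semigroup T \<longleftrightarrow>
    (\<forall>t\<ge>0. bounded_linear (T t) \<and> (\<forall>c f. T t (c *\<^sub>C f) = c *\<^sub>C T t f)) \<and>
    T 0 = id \<and>
    (\<forall>s\<ge>0. \<forall>t\<ge>0. T (s + t) = T s \<circ> T t) \<and>
    (\<forall>f. ((\<lambda>t. T t f) \<longlongrightarrow> f) (at_right 0))"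

definition generator ::
    "(real \<Rightarrow> 'a :: banach_lattice complexification \<Rightarrow> 'a complexification) \<Rightarrow>
      'a complexification operator"
  where "generator T =
    ({f. \<exists>g. ((\<lambda>t. (T t f - f) /\<^sub>R t) \<longlongrightarrow> g) (at_right 0)},
     \<lambda>f. Lim (at_right 0) (\<lambda>t. (T t f - f) /\<^sub>R t))"

definition bounded_semigroup ::
    "(real \<Rightarrow> 'a :: banach_lattice complexification \<Rightarrow> 'a complexification) \<Rightarrow> bool"
  where "bounded_semigroup T \<longleftrightarrow> (\<exists>M. \<forall>t\<ge>0. \<forall>f. norm (T t f) \<le> M * norm f)"

definition rescaled ::
    "real \<Rightarrow> (real \<Rightarrow> 'a :: banach_lattice complexification \<Rightarrow> 'a complexification) \<Rightarrow>
      real \<Rightarrow> 'a complexification \<Rightarrow> 'a complexification"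
  where "rescaled s T = (\<lambda>t f. exp (- (t * s)) *\<^sub>R T t f)"

text \<open>
  For \<open>s(A) = 0\<close> the rescaling is trivial, so both cases of the usual definition (\<open>s(A) = 0\<close> and
  \<open>s(A) \<noteq> 0\<close>) are covered at once. In particular \<open>s(A)\<close> has to be finite.
\<close>

definition uniformly_asymptotically_positive ::
    "(real \<Rightarrow> 'a :: banach_lattice complexification \<Rightarrow> 'a complexification) \<Rightarrow> bool"
  where "uniformly_asymptotically_positive T \<longleftrightarrow>
    (\<exists>s. spectral_bound (generator T) = ereal s \<and>
      bounded_semigroup (rescaled s T) \<and>
      (\<forall>\<epsilon>>0. \<exists>t\<^sub>0\<ge>0. \<forall>t\<ge>t\<^sub>0. \<forall>f\<in>positive_cone.
        infdist (rescaled s T t f) positive_cone \<le> \<epsilon> * norm f))"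

end

theory Submission
  imports Defs
begin

text \<open>
  After rescaling, \<open>s = 0\<close> and the semigroup \<open>U\<close> is bounded. Since the half plane to the right of
  \<open>\<i>\<beta>\<close> lies in the resolvent set, a spectral value \<open>\<i>\<beta>\<close> has approximate eigenvectors \<open>f\<close>, so
  \<open>e\<^bsup>-\<i>\<beta>t\<^esup> U t f \<approx> f\<close> on long time intervals. Write \<open>f \<approx> \<Sum> \<zeta> w\<^sub>\<zeta>\<close> with finitely many unit numbers \<open>\<zeta>\<close>,
  \<open>w\<^sub>\<zeta> \<ge> 0\<close> and \<open>\<Sum> w\<^sub>\<zeta> = h = |f|\<close>, and put \<open>f\<^sub>n = \<Sum> \<zeta>\<^sup>n w\<^sub>\<zeta>\<close>. For \<open>|\<xi>| = 1\<close> and \<open>K = n\<^sup>2 + 1\<close> one has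
  \<open>K (h - Re (\<xi>\<^sup>-\<^sup>1 f)) \<ge> h - Re (\<xi>\<^bsup>-n\<^esup> f\<^sub>n)\<close>. Apply \<open>U t\<close>, which is almost positive on the \<open>w\<^sub>\<zeta>\<close>, rotate \<open>\<xi>\<close>
  along with \<open>e\<^bsup>\<i>\<beta>t\<^esup>\<close>, and average over a long time interval: with \<open>P\<close> the average of \<open>U t\<close>,
  \<open>K (P h - Re (\<xi>\<^sup>-\<^sup>1 f)) \<ge> P h - Re (\<xi>\<^bsup>-n\<^esup> G)\<close> up to small errors, where \<open>G\<close> is the average of
  \<open>e\<^bsup>-\<i>n\<beta>t\<^esup> U t f\<^sub>n\<close>. If \<open>\<i>n\<beta>\<close> were in the resolvent set, \<open>G\<close> would be small, and the supremum over
  \<open>\<xi>\<close> would give \<open>h \<le> q P h\<close> with \<open>q = (K - 1) / K < 1\<close> up to a small error. Iterating contradicts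
  \<open>\<parallel>h\<parallel> = 1\<close>, because the powers of \<open>P\<close> are uniformly bounded.
\<close>

section \<open>Disjointness and Riesz decomposition\<close>

text \<open>By distributivity the right side is the meet of the four sums \<open>x + y\<close>,
  \<open>x + z\<close>, \<open>z + y\<close> and \<open>z + z\<close>, each of which dominates the
  left side.\<close>

lemma inf_add_le:
  fixes x y z :: "'a :: lattice_ab_group_add"
  assumes "0 \<le> x" "0 \<le> y" "0 \<le> z"
  shows "inf (x + y) z \<le> inf x z + inf y z"
proof -
  have "inf (x + y) z \<le> x + z" "inf (x + y) z \<le> z + y" "inf (x + y) z \<le> z + z"
    using assms by (auto intro: le_infI2 add_increasing add_increasing2)
  then show ?thesis
    by (simp add: add_inf_distrib_left add_inf_distrib_right)
qed

lemma disjoint_sum: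
  fixes w :: "'i \<Rightarrow> 'a :: lattice_ab_group_add"
  assumes "finite I" "0 \<le> r" "\<And>i. i \<in> I \<Longrightarrow> 0 \<le> w i" "\<And>i. i \<in> I \<Longrightarrow> inf (w i) r = 0"
  shows "inf (\<Sum>i\<in>I. w i) r = 0"
  using assms
proof (induction I rule: finite_induct)
  case empty
  then show ?case by (simp add: inf.absorb1)
next
  case (insert i I)
  have "inf (w i + sum w I) r \<le> inf (w i) r + inf (sum w I) r"
    using insert by (intro inf_add_le sum_nonneg) auto
  also have "\<dots> = 0" using insert by simp
  finally have "inf (w i + sum w I) r \<le> 0" .
  moreover have "0 \<le> inf (w i + sum w I) r"
    using insert by (auto intro!: add_nonneg_nonneg sum_nonneg)
  ultimately show ?case using insert by (simp add: order.antisym)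
qed

text \<open>With \<open>d = max c 1\<close> the meet lies below \<open>d *\<^sub>R x\<close> and
  below \<open>d *\<^sub>R y\<close>; dividing by \<open>d\<close> puts it below
  \<open>inf x y\<close>, which is 0.\<close>

lemma disjoint_scaleR:
  fixes x y :: "'a :: banach_lattice"
  assumes "inf x y = 0" "0 \<le> c"
  shows "inf (c *\<^sub>R x) y = 0"
proof -
  have nn: "0 \<le> x" "0 \<le> y" using assms(1) by (metis inf.cobounded1 inf.cobounded2)+
  define d where "d = max c 1"
  have d: "0 < d" "c \<le> d" "1 \<le> d" by (auto simp: d_def)
  have "inverse d *\<^sub>R inf (c *\<^sub>R x) y \<le> x"
  proof -
    have "inf (c *\<^sub>R x) y \<le> d *\<^sub>R x"
      using scaleR_right_mono[OF d(2) nn(1)] by (rule le_infI1)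
    from scaleR_left_mono[OF this, of "inverse d"] show ?thesis using d by simp
  qed
  moreover have "inverse d *\<^sub>R inf (c *\<^sub>R x) y \<le> y"
  proof -
    have "inf (c *\<^sub>R x) y \<le> d *\<^sub>R y"
      using scaleR_right_mono[OF d(3) nn(2)] by (intro le_infI2) simp
    from scaleR_left_mono[OF this, of "inverse d"] show ?thesis using d by simp
  qed
  ultimately have "inverse d *\<^sub>R inf (c *\<^sub>R x) y \<le> 0" using assms(1) by (metis le_inf_iff)
  from scaleR_left_mono[OF this, of d] have "inf (c *\<^sub>R x) y \<le> 0" using d by simp
  moreover have "0 \<le> inf (c *\<^sub>R x) y" using nn assms(2) by (simp add: scaleR_nonneg_nonneg)
  ultimately show ?thesis by (rule order.antisym)
qed

lemma le_pprt: "a \<le> pprt (a :: 'a :: lattice_ab_group_add)"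
  by (simp add: pprt_def)

lemma pprt_le: "a \<le> b \<Longrightarrow> 0 \<le> b \<Longrightarrow> pprt a \<le> (b :: 'a :: lattice_ab_group_add)"
  by (simp add: pprt_def)

text \<open>Translating \<open>a\<close> and 0 by \<open>- nprt a\<close> gives the two arguments,
  so their meet is \<open>inf a 0 - nprt a\<close>, which vanishes.\<close>

lemma disjoint_pprt_nprt: "inf (pprt a) (- nprt a) = (0 :: 'a :: lattice_ab_group_add)"
proof -
  have "inf (pprt a) (- nprt a) = inf (a + - nprt a) (0 + - nprt a)"
    using prts[of a] by (metis add_diff_cancel_right' add_0_left diff_conv_add_uminus)
  also have "\<dots> = inf a 0 + - nprt a" by (rule add_inf_distrib_right[symmetric])
  finally show ?thesis by (simp only: nprt_def right_minus)
qed

text \<open>In a function lattice, \<open>b > 0\<close> forces \<open>a < 0\<close>. In general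
  \<open>b\<close> is below \<alpha> times the negative part of \<open>a\<close>, hence so is
  \<open>pprt b\<close>, and that negative part is disjoint from \<open>pprt a\<close>.\<close>

lemma disjoint_pprt:
  fixes a b :: "'a :: banach_lattice"
  assumes "\<alpha> *\<^sub>R a + b \<le> 0" "0 \<le> \<alpha>"
  shows "inf (pprt a) (pprt b) = 0"
proof -
  have "b \<le> \<alpha> *\<^sub>R (- a)" using assms(1) by (simp add: le_eq_neg add.commute)
  also have "\<dots> \<le> \<alpha> *\<^sub>R (- nprt a)"
    using assms(2) by (intro scaleR_left_mono) (simp_all add: nprt_def)
  finally have "pprt b \<le> \<alpha> *\<^sub>R (- nprt a)"
    by (rule pprt_le) (use assms(2) in \<open>simp add: scaleR_nonneg_nonneg del: scaleR_minus_right\<close>)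
  then have "inf (pprt a) (pprt b) \<le> inf (\<alpha> *\<^sub>R (- nprt a)) (pprt a)"
    by (metis inf.commute inf_mono order_refl)
  also have "\<dots> = 0"
    using assms(2) by (intro disjoint_scaleR) (simp_all add: disjoint_pprt_nprt inf.commute)
  finally show ?thesis by (intro order.antisym) simp_all
qed

text \<open>Greedy choice: one index takes \<open>inf h (k i)\<close>, and the remainder
  \<open>h - inf h (k i) = sup 0 (h - k i)\<close> stays below the sum over the other
  indices.\<close>

lemma riesz_decomposition:
  fixes k :: "'i \<Rightarrow> 'a :: lattice_ab_group_add"
  assumes "finite I" "\<And>i. i \<in> I \<Longrightarrow> 0 \<le> k i" "0 \<le> h" "h \<le> (\<Sum>i\<in>I. k i)"
  shows "\<exists>w. (\<forall>i\<in>I. 0 \<le> w i \<and> w i \<le> k i) \<and> (\<Sum>i\<in>I. w i) = h"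
  using assms
proof (induction I arbitrary: h rule: finite_induct)
  case empty
  then show ?case by auto
next
  case (insert i I)
  have "h - inf h (k i) = sup 0 (h - k i)"
    by (simp add: diff_inf_eq_sup add_sup_distrib_left)
  also have "\<dots> \<le> sum k I"
    using insert by (auto intro!: sum_nonneg simp: algebra_simps)
  finally obtain w where w: "\<forall>j\<in>I. 0 \<le> w j \<and> w j \<le> k j" "sum w I = h - inf h (k i)"
    using insert by (metis diff_ge_0_iff_ge inf_le1 insertCI)
  obtain m where m: "m = inf h (k i)" by simp
  have "sum (w(i := m)) I = sum w I"
    using insert by (intro sum.cong) auto
  then have "sum (w(i := m)) (insert i I) = h"
    using w(2) insert by (simp add: m[symmetric])
  moreover have "0 \<le> m" "m \<le> k i" using insert by (simp_all add: m)
  ultimately show ?case using w(1)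
    by (intro exI[of _ "w(i := m)"]) auto
qed

text \<open>In a function lattice the hypothesis on \<open>w j\<close> says that \<open>x \<le> (c j + \<eta>) h\<close> wherever
  \<open>w j > 0\<close>, and multiplying by \<open>w j / h\<close> and summing gives the claim. In an abstract lattice the
  division is replaced by showing that the positive part of the difference is disjoint from every
  \<open>w j\<close>, in increasing order of \<open>c j\<close>.\<close>

lemma le_weighted_sum:
  fixes w :: "'i \<Rightarrow> 'a :: banach_lattice"
  assumes fin: "finite I" and w: "\<And>j. j \<in> I \<Longrightarrow> 0 \<le> w j" and h: "h = (\<Sum>j\<in>I. w j)"
    and x: "x \<le> h" and c: "\<And>j. j \<in> I \<Longrightarrow> \<bar>c j\<bar> \<le> 1" and \<eta>: "0 \<le> \<eta>"
    and disj: "\<And>j. j \<in> I \<Longrightarrow> inf (pprt (x - (c j + \<eta>) *\<^sub>R h)) (w j) = 0"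
  shows "x \<le> (\<Sum>j\<in>I. c j *\<^sub>R w j) + \<eta> *\<^sub>R h"
proof -
  define y where "y = x - (\<Sum>j\<in>I. c j *\<^sub>R w j) - \<eta> *\<^sub>R h"
  define r where "r = pprt y"
  have r0: "0 \<le> r" by (simp add: r_def)
  have h0: "0 \<le> h" using w h by (simp add: sum_nonneg)
  have *: "inf (w j) r = 0" if "j \<in> I" for j
    using that
  \<comment> \<open>Counting the strictly smaller coefficients follows the order of \<open>c\<close>
    even when values repeat.\<close>
  proof (induction "card {i \<in> I. c i < c j}" arbitrary: j rule: less_induct)
    case less
    define J where "J = {i \<in> I. c i < c j}"
    define a where "a = pprt (x - (c j + \<eta>) *\<^sub>R h)"
    define b where "b = (\<Sum>i\<in>J. (c j - c i) *\<^sub>R w i)"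
    have finJ: "finite J" using fin by (simp add: J_def)
    have a0: "0 \<le> a" by (simp add: a_def)
    have b0: "0 \<le> b" unfolding b_def using w by (intro sum_nonneg scaleR_nonneg_nonneg) (auto simp: J_def)
    have br: "inf b r = 0"
      unfolding b_def
    proof (rule disjoint_sum[OF finJ r0])
      fix i assume i: "i \<in> J"
      show "0 \<le> (c j - c i) *\<^sub>R w i" using i w by (intro scaleR_nonneg_nonneg) (auto simp: J_def)
      have "{k \<in> I. c k < c i} \<subset> {k \<in> I. c k < c j}" using i by (auto simp: J_def)
      then have "card {k \<in> I. c k < c i} < card {k \<in> I. c k < c j}"
        using fin by (intro psubset_card_mono) auto
      with less i have "inf (w i) r = 0" by (auto simp: J_def)
      then show "inf ((c j - c i) *\<^sub>R w i) r = 0" using i by (intro disjoint_scaleR) (auto simp: J_def)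
    qed
    have "(\<Sum>i\<in>I. (c j - c i) *\<^sub>R w i) \<le> (\<Sum>i\<in>I. if i \<in> J then (c j - c i) *\<^sub>R w i else 0)"
    proof (rule sum_mono)
      fix i assume "i \<in> I"
      then show "(c j - c i) *\<^sub>R w i \<le> (if i \<in> J then (c j - c i) *\<^sub>R w i else 0)"
        using w[of i] by (auto simp: J_def intro: scaleR_nonpos_nonneg)
    qed
    also have "\<dots> = b" unfolding b_def using fin
      by (subst sum.inter_restrict[symmetric]) (auto simp: J_def intro!: sum.cong)
    finally have le_b: "(\<Sum>i\<in>I. (c j - c i) *\<^sub>R w i) \<le> b" .
    \<comment> \<open>Since \<open>h\<close> is the sum of the \<open>w i\<close>, the constant
      \<open>c j\<close> can be moved into the sum. Terms with \<open>c i \<ge> c j\<close> are at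
      most 0; the others form \<open>b\<close>, which is disjoint from \<open>r\<close> by
      induction.\<close>
    have "y = (x - (c j + \<eta>) *\<^sub>R h) + (\<Sum>i\<in>I. (c j - c i) *\<^sub>R w i)"
      unfolding y_def h by (simp add: algebra_simps scaleR_right.sum sum_subtractf sum.distrib)
    also have "\<dots> \<le> a + b" unfolding a_def using le_b by (intro add_mono le_pprt)
    finally have "r \<le> a + b" unfolding r_def using a0 b0 by (intro pprt_le) auto
    then have "inf (w j) r \<le> inf (a + b) (inf (w j) r)" by (simp add: le_infI2)
    also have "\<dots> \<le> inf a (inf (w j) r) + inf b (inf (w j) r)"
      using a0 b0 r0 w less by (intro inf_add_le) auto
    also have "\<dots> \<le> inf a (w j) + inf b r"
      by (intro add_mono inf_mono) auto
    also have "\<dots> = 0" using disj[of j] less br by (simp add: a_def)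
    finally show ?case using w less r0 by (intro order.antisym) auto
  qed
  \<comment> \<open>Disjointness now forces \<open>r\<close> to vanish: it is disjoint from
    \<open>2 *\<^sub>R h\<close> and also lies below it.\<close>
  have "inf h r = 0" unfolding h using fin r0 w * by (rule disjoint_sum)
  then have hr: "inf (2 *\<^sub>R h) r = 0" by (rule disjoint_scaleR) simp
  have "- h \<le> (\<Sum>j\<in>I. c j *\<^sub>R w j)"
    unfolding h sum_negf[symmetric]
  proof (rule sum_mono)
    fix j assume "j \<in> I"
    then have "(- 1) *\<^sub>R w j \<le> c j *\<^sub>R w j" using c[of j] w by (intro scaleR_right_mono) auto
    then show "- w j \<le> c j *\<^sub>R w j" by simp
  qed
  moreover have "0 \<le> \<eta> *\<^sub>R h" using h0 \<eta> by (rule scaleR_nonneg_nonneg[rotated])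
  ultimately have "y \<le> h - (- h) - 0" unfolding y_def using x by (intro diff_mono)
  then have "r \<le> 2 *\<^sub>R h" unfolding r_def using h0 by (intro pprt_le) (auto simp: scaleR_2)
  with hr have "r = 0" by (metis inf.absorb2)
  then have "y \<le> 0" by (metis le_pprt r_def)
  then show ?thesis by (simp add: y_def algebra_simps)
qed

section \<open>Simple approximation of a vector\<close>

lemma unit_circle_net:
  assumes "0 < \<delta>"
  obtains Z :: "complex set" where "finite Z" "\<And>\<zeta>. \<zeta> \<in> Z \<Longrightarrow> cmod \<zeta> = 1"
    "\<And>\<xi>. cmod \<xi> = 1 \<Longrightarrow> \<exists>\<zeta>\<in>Z. cmod (\<xi> - \<zeta>) \<le> \<delta>"
proof -
  have "seq_compact (sphere (0::complex) 1)" by (simp add: compact_imp_seq_compact)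
  from seq_compact_imp_totally_bounded[OF this, rule_format, OF assms]
  obtain Z :: "complex set"
    where Z: "finite Z" "Z \<subseteq> sphere 0 1" "sphere 0 1 \<subseteq> (\<Union>\<zeta>\<in>Z. ball \<zeta> \<delta>)"
    by blast
  show thesis
  proof (rule that[of Z])
    fix \<xi> :: complex assume "cmod \<xi> = 1"
    then have "\<xi> \<in> (\<Union>\<zeta>\<in>Z. ball \<zeta> \<delta>)"
      by (intro subsetD[OF Z(3)]) simp
    then obtain \<zeta> where "\<zeta> \<in> Z" "dist \<xi> \<zeta> < \<delta>" by (auto simp: dist_commute)
    then show "\<exists>\<zeta>\<in>Z. cmod (\<xi> - \<zeta>) \<le> \<delta>"
      by (intro bexI[of _ \<zeta>]) (simp_all add: dist_norm)
  qed (use Z in auto)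
qed

lemma real_part_unit_le_modulus:
  assumes "cmod \<zeta> = 1"
  shows "real_part (\<zeta> *\<^sub>C z) \<le> modulus z"
proof -
  have "cis (Arg \<zeta>) = \<zeta>" using rcis_cmod_Arg[of \<zeta>] assms by (simp add: rcis_def)
  with modulus_upper[of "Arg \<zeta>" z] show ?thesis by (simp only:)
qed

lemma real_part_scaleC_le_modulus: "real_part (c *\<^sub>C z) \<le> cmod c *\<^sub>R modulus z"
proof -
  have "real_part (c *\<^sub>C z) \<le> modulus (c *\<^sub>C z)"
    by (rule order_trans[OF abs_ge_self abs_real_part_le_modulus])
  then show ?thesis by (simp only: modulus_scaleC)
qed

text \<open>Replacing a direction by a nearby net point changes the real part by at most \<delta>
  times the modulus, so finitely many directions almost control the modulus.\<close>

lemma modulus_le_net: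
  assumes net: "\<And>\<xi>. cmod \<xi> = 1 \<Longrightarrow> \<exists>\<zeta>\<in>Z. cmod (\<xi> - \<zeta>) \<le> \<delta>"
    and le: "\<And>\<zeta>. \<zeta> \<in> Z \<Longrightarrow> real_part (cnj \<zeta> *\<^sub>C f) \<le> u"
  shows "modulus f \<le> u + \<delta> *\<^sub>R modulus f"
proof (rule modulus_least)
  fix \<theta>
  obtain \<zeta> where \<zeta>: "\<zeta> \<in> Z" "cmod (cnj (cis \<theta>) - \<zeta>) \<le> \<delta>"
    using net[of "cnj (cis \<theta>)"] by auto
  have "cmod (cis \<theta> - cnj \<zeta>) \<le> \<delta>"
    using \<zeta>(2) by (metis complex_cnj_cnj complex_cnj_diff complex_mod_cnj)
  then have "real_part ((cis \<theta> - cnj \<zeta>) *\<^sub>C f) \<le> \<delta> *\<^sub>R modulus f"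
    by (meson modulus_nonneg order_trans real_part_scaleC_le_modulus scaleR_right_mono)
  with le[OF \<zeta>(1)]
  have "real_part (cnj \<zeta> *\<^sub>C f) + real_part ((cis \<theta> - cnj \<zeta>) *\<^sub>C f) \<le> u + \<delta> *\<^sub>R modulus f"
    by (rule add_mono)
  then show "real_part (cis \<theta> *\<^sub>C f) \<le> u + \<delta> *\<^sub>R modulus f"
    by (simp add: algebra_simps)
qed

lemma real_part_sum: "real_part (\<Sum>i\<in>I. z i) = (\<Sum>i\<in>I. real_part (z i))"
  by (induction I rule: infinite_finite_induct) auto

lemma scaleC_zero_right [simp]: "c *\<^sub>C 0 = 0"
  by (rule complexification_eqI) simp_all

lemma scaleC_sum_right: "c *\<^sub>C (\<Sum>i\<in>I. z i) = (\<Sum>i\<in>I. c *\<^sub>C z i)"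
  by (induction I rule: infinite_finite_induct) (simp_all add: scaleC_add_right)

lemma unit_add_le:
  assumes "cmod \<zeta> = 1" "cmod \<xi> = 1" "0 \<le> \<alpha>"
  shows "cmod (of_real \<alpha> * cnj \<xi> + cnj \<zeta>) \<le> 1 + \<alpha> * Re (cnj \<xi> * \<zeta>) + \<alpha>\<^sup>2 / 2"
proof -
  define c where "c = Re (cnj \<xi> * \<zeta>)"
  have u: "(Re \<zeta>)\<^sup>2 + (Im \<zeta>)\<^sup>2 = 1" "(Re \<xi>)\<^sup>2 + (Im \<xi>)\<^sup>2 = 1"
    using assms by (simp_all add: cmod_def)
  have "\<bar>c\<bar> \<le> 1" unfolding c_def
    using abs_Re_le_cmod[of "cnj \<xi> * \<zeta>"] assms by (simp add: norm_mult)
  then have c: "- 1 \<le> c" by simp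
  have "(cmod (of_real \<alpha> * cnj \<xi> + cnj \<zeta>))\<^sup>2 = \<alpha>\<^sup>2 * ((Re \<xi>)\<^sup>2 + (Im \<xi>)\<^sup>2) + 2 * \<alpha> * c + ((Re \<zeta>)\<^sup>2 + (Im \<zeta>)\<^sup>2)"
    unfolding cmod_power2 by (simp add: c_def power2_eq_square algebra_simps)
  also have "\<dots> = 1 + 2 * (\<alpha> * c + \<alpha>\<^sup>2 / 2)" by (simp only: u) (simp add: algebra_simps)
  also have "\<dots> \<le> (1 + \<alpha> * c + \<alpha>\<^sup>2 / 2)\<^sup>2"
  proof -
    have "(1 + \<alpha> * c + \<alpha>\<^sup>2 / 2)\<^sup>2 = 1 + 2 * (\<alpha> * c + \<alpha>\<^sup>2 / 2) + (\<alpha> * c + \<alpha>\<^sup>2 / 2)\<^sup>2"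
      by (simp add: power2_eq_square algebra_simps)
    then show ?thesis by simp
  qed
  finally have "(cmod (of_real \<alpha> * cnj \<xi> + cnj \<zeta>))\<^sup>2 \<le> (1 + \<alpha> * c + \<alpha>\<^sup>2 / 2)\<^sup>2" .
  moreover have "0 \<le> 1 + \<alpha> * c + \<alpha>\<^sup>2 / 2"
  proof -
    have "\<alpha> * c \<ge> - \<alpha>" using mult_left_mono[OF c assms(3)] by simp
    moreover have "0 \<le> (1 - \<alpha>)\<^sup>2" by simp
    ultimately show ?thesis by (simp add: power2_eq_square algebra_simps)
  qed
  ultimately show ?thesis unfolding c_def by (rule power2_le_imp_le)
qed

text \<open>For a unit number u, Re (cnj \<zeta> u) > 1 - \<eta>^2 / 2 implies |u - \<zeta>| <
  \<eta>. The positive parts \<open>k \<zeta>\<close> mark where \<open>f\<close> has almost the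
  direction \<zeta>; their sum dominates a multiple of \<open>modulus f\<close>, which Riesz
  decomposition then splits into pieces \<open>w \<zeta>\<close> living there.\<close>

lemma simple_approximation:
  fixes f :: "'a :: banach_lattice complexification"
  assumes \<eta>: "0 < \<eta>" "\<eta> \<le> 1" and fin: "finite Z" and unit: "\<And>\<zeta>. \<zeta> \<in> Z \<Longrightarrow> cmod \<zeta> = 1"
    and net: "\<And>\<xi>. cmod \<xi> = 1 \<Longrightarrow> \<exists>\<zeta>\<in>Z. cmod (\<xi> - \<zeta>) \<le> \<eta>\<^sup>2 / 4"
  obtains w where "\<And>\<zeta>. \<zeta> \<in> Z \<Longrightarrow> 0 \<le> w \<zeta>" "(\<Sum>\<zeta>\<in>Z. w \<zeta>) = modulus f"
    "modulus (f - (\<Sum>\<zeta>\<in>Z. \<zeta> *\<^sub>C Cx (w \<zeta>) 0)) \<le> \<eta> *\<^sub>R modulus f"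
proof -
  define h where "h = modulus f"
  have h0: "0 \<le> h" by (simp add: h_def)
  define k where "k \<zeta> = pprt (real_part (cnj \<zeta> *\<^sub>C f) - (1 - \<eta>\<^sup>2 / 2) *\<^sub>R h)" for \<zeta>
  have "h \<le> ((\<Sum>\<zeta>\<in>Z. k \<zeta>) + (1 - \<eta>\<^sup>2 / 2) *\<^sub>R h) + (\<eta>\<^sup>2 / 4) *\<^sub>R h"
    unfolding h_def
  proof (rule modulus_le_net[OF net])
    fix \<zeta> assume "\<zeta> \<in> Z"
    then have "k \<zeta> \<le> sum k Z"
      using fin sum_mono2[of Z "{\<zeta>}" k] by (auto simp: k_def)
    then have "real_part (cnj \<zeta> *\<^sub>C f) - (1 - \<eta>\<^sup>2 / 2) *\<^sub>R h \<le> sum k Z"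
      unfolding k_def[of \<zeta>] by (rule order_trans[OF le_pprt])
    then show "real_part (cnj \<zeta> *\<^sub>C f) \<le> sum k Z + (1 - \<eta>\<^sup>2 / 2) *\<^sub>R modulus f"
      by (simp only: h_def[symmetric] diff_le_eq)
  qed
  \<comment> \<open>The threshold in \<open>k\<close> leaves room \<eta>^2 / 2; the net uses up half
    of it, and the other half bounds the sum of the \<open>k \<zeta>\<close> from below.\<close>
  moreover have "(\<eta>\<^sup>2 / 2) *\<^sub>R h = (\<eta>\<^sup>2 / 4) *\<^sub>R h + (\<eta>\<^sup>2 / 4) *\<^sub>R h"
    by (simp only: scaleR_left_distrib[symmetric]) simp
  ultimately have "(\<eta>\<^sup>2 / 4) *\<^sub>R h \<le> (\<Sum>\<zeta>\<in>Z. k \<zeta>)"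
    by (simp only: scaleR_left_diff_distrib scaleR_one) (simp add: algebra_simps)
  from scaleR_left_mono[OF this, of "4 / \<eta>\<^sup>2"] have "h \<le> (\<Sum>\<zeta>\<in>Z. (4 / \<eta>\<^sup>2) *\<^sub>R k \<zeta>)"
    using \<eta> by (simp add: scaleR_right.sum)
  then obtain w where w: "\<And>\<zeta>. \<zeta> \<in> Z \<Longrightarrow> 0 \<le> w \<zeta>" "\<And>\<zeta>. \<zeta> \<in> Z \<Longrightarrow> w \<zeta> \<le> (4 / \<eta>\<^sup>2) *\<^sub>R k \<zeta>"
    "sum w Z = h"
    using riesz_decomposition[OF fin _ h0, of "\<lambda>\<zeta>. (4 / \<eta>\<^sup>2) *\<^sub>R k \<zeta>"]
    by (auto simp: k_def scaleR_nonneg_nonneg)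
  show thesis
  proof (rule that[OF w(1) w(3)[unfolded h_def]])
    show "modulus (f - (\<Sum>\<zeta>\<in>Z. \<zeta> *\<^sub>C Cx (w \<zeta>) 0)) \<le> \<eta> *\<^sub>R modulus f"
    proof (rule modulus_least)
      fix \<theta>
      define \<xi> where "\<xi> = cnj (cis \<theta>)"
      define x where "x = real_part (cnj \<xi> *\<^sub>C f)"
      define c where "c \<zeta> = Re (cnj \<xi> * \<zeta>)" for \<zeta>
      have \<xi>: "cmod \<xi> = 1" by (simp add: \<xi>_def)
      have "x \<le> (\<Sum>\<zeta>\<in>Z. c \<zeta> *\<^sub>R w \<zeta>) + \<eta> *\<^sub>R h"
      proof (rule le_weighted_sum[OF fin w(1) w(3)[symmetric]])
        show "x \<le> h" unfolding x_def h_def using \<xi> by (intro real_part_unit_le_modulus) simp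
        show "\<bar>c \<zeta>\<bar> \<le> 1" if "\<zeta> \<in> Z" for \<zeta>
          using abs_Re_le_cmod[of "cnj \<xi> * \<zeta>"] unit[OF that] \<xi> by (simp add: c_def norm_mult)
        show "inf (pprt (x - (c \<zeta> + \<eta>) *\<^sub>R h)) (w \<zeta>) = 0" if \<zeta>: "\<zeta> \<in> Z" for \<zeta>
        proof -
          \<comment> \<open>Here \<open>f\<close> is tested in \<zeta> and \<eta> times \<xi>
            combined. Where the \<zeta> component exceeds (1 - \<eta>^2 / 2) \<open>h\<close>, at
            most (\<open>c \<zeta>\<close> + \<eta>) \<open>h\<close> is left for the \<xi>
            component \<open>x\<close>.\<close>
          have "\<eta> *\<^sub>R x + real_part (cnj \<zeta> *\<^sub>C f) = real_part ((of_real \<eta> * cnj \<xi> + cnj \<zeta>) *\<^sub>C f)"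
            by (simp add: x_def algebra_simps)
          also have "\<dots> \<le> cmod (of_real \<eta> * cnj \<xi> + cnj \<zeta>) *\<^sub>R h"
            unfolding h_def by (rule real_part_scaleC_le_modulus)
          also have "\<dots> \<le> (1 + \<eta> * c \<zeta> + \<eta>\<^sup>2 / 2) *\<^sub>R h"
            using unit_add_le[OF unit[OF \<zeta>] \<xi>, of \<eta>] \<eta> h0 unfolding c_def
            by (intro scaleR_right_mono) auto
          finally have "\<eta> *\<^sub>R x + real_part (cnj \<zeta> *\<^sub>C f) - (1 + \<eta> * c \<zeta> + \<eta>\<^sup>2 / 2) *\<^sub>R h \<le> 0"
            by (simp only: diff_le_0_iff_le)
          also have "\<eta> *\<^sub>R x + real_part (cnj \<zeta> *\<^sub>C f) - (1 + \<eta> * c \<zeta> + \<eta>\<^sup>2 / 2) *\<^sub>R h =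
              \<eta> *\<^sub>R (x - (c \<zeta> + \<eta>) *\<^sub>R h) + (real_part (cnj \<zeta> *\<^sub>C f) - (1 - \<eta>\<^sup>2 / 2) *\<^sub>R h)"
          proof -
            have "1 + \<eta> * c \<zeta> + \<eta>\<^sup>2 / 2 = \<eta> * (c \<zeta> + \<eta>) + (1 - \<eta>\<^sup>2 / 2)"
              by (simp add: field_simps power2_eq_square)
            then have "(1 + \<eta> * c \<zeta> + \<eta>\<^sup>2 / 2) *\<^sub>R h = (\<eta> * (c \<zeta> + \<eta>) + (1 - \<eta>\<^sup>2 / 2)) *\<^sub>R h"
              by (rule arg_cong)
            also have "\<dots> = \<eta> *\<^sub>R ((c \<zeta> + \<eta>) *\<^sub>R h) + (1 - \<eta>\<^sup>2 / 2) *\<^sub>R h"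
              unfolding scaleR_scaleR by (rule scaleR_left_distrib)
            finally show ?thesis by (simp only: scaleR_right_diff_distrib add_diff_add)
          qed
          finally have "inf (pprt (x - (c \<zeta> + \<eta>) *\<^sub>R h)) (k \<zeta>) = 0"
            unfolding k_def using \<eta> by (intro disjoint_pprt[of \<eta>]) auto
          then have "inf ((4 / \<eta>\<^sup>2) *\<^sub>R k \<zeta>) (pprt (x - (c \<zeta> + \<eta>) *\<^sub>R h)) = 0"
            by (intro disjoint_scaleR) (auto simp: inf.commute)
          then have "inf (pprt (x - (c \<zeta> + \<eta>) *\<^sub>R h)) (w \<zeta>) \<le> 0"
            using w(2)[OF \<zeta>] by (metis inf.commute inf_mono order_refl)
          then show ?thesis using w(1)[OF \<zeta>] by (intro order.antisym) auto
        qed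
      qed (use \<eta> in auto)
      moreover have "real_part (cis \<theta> *\<^sub>C (f - (\<Sum>\<zeta>\<in>Z. \<zeta> *\<^sub>C Cx (w \<zeta>) 0)))
          = x - (\<Sum>\<zeta>\<in>Z. c \<zeta> *\<^sub>R w \<zeta>)"
      proof -
        have "real_part (cis \<theta> *\<^sub>C (\<Sum>\<zeta>\<in>Z. \<zeta> *\<^sub>C Cx (w \<zeta>) 0)) = (\<Sum>\<zeta>\<in>Z. c \<zeta> *\<^sub>R w \<zeta>)"
          unfolding scaleC_sum_right real_part_sum scaleC_scaleC
          by (intro sum.cong) (auto simp: c_def \<xi>_def)
        moreover have "cis \<theta> *\<^sub>C (f - g) = cis \<theta> *\<^sub>C f - cis \<theta> *\<^sub>C g" for g
          by (rule complexification_eqI) (simp_all add: algebra_simps)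
        ultimately show ?thesis by (simp only: x_def \<xi>_def complex_cnj_cnj complexification_parts)
      qed
      ultimately show "real_part (cis \<theta> *\<^sub>C (f - (\<Sum>\<zeta>\<in>Z. \<zeta> *\<^sub>C Cx (w \<zeta>) 0))) \<le> \<eta> *\<^sub>R modulus f"
        by (simp only: h_def[symmetric] diff_le_eq) (simp add: add.commute)
    qed
  qed
qed

section \<open>Failure of positivity and integration\<close>

lemma pprt_add_le: "pprt (a + b) \<le> pprt a + pprt (b :: 'a :: lattice_ab_group_add)"
  by (intro pprt_le add_mono le_pprt add_nonneg_nonneg zero_le_pprt)

lemma norm_mono_nonneg: "0 \<le> x \<Longrightarrow> x \<le> y \<Longrightarrow> norm x \<le> norm (y :: 'a :: banach_lattice)"
  by (rule norm_le_if_abs_le) simp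

lemma norm_pprt_le: "a \<le> b \<Longrightarrow> 0 \<le> b \<Longrightarrow> norm (pprt a) \<le> norm (b :: 'a :: banach_lattice)"
  by (intro norm_mono_nonneg pprt_le zero_le_pprt)

lemma norm_modulus: "norm (modulus z) = norm z"
  by (simp add: norm_complexification_def)

lemma norm_real_part_le: "norm (real_part z) \<le> norm (z :: 'a :: banach_lattice complexification)"
  unfolding norm_modulus[symmetric] by (intro norm_le_if_abs_le abs_real_part_le_modulus)

lemma norm_imag_part_le: "norm (imag_part z) \<le> norm (z :: 'a :: banach_lattice complexification)"
  unfolding norm_modulus[symmetric] by (intro norm_le_if_abs_le abs_imag_part_le_modulus)

lemma bounded_bilinear_scaleC:
  "bounded_bilinear (scaleC :: complex \<Rightarrow> 'a :: banach_lattice complexification \<Rightarrow> _)"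
proof
  show "\<exists>K. \<forall>c (z :: 'a complexification). norm (c *\<^sub>C z) \<le> norm c * norm z * K"
    by (intro exI[of _ 1]) (simp add: norm_scaleC)
qed (auto intro!: complexification_eqI simp: algebra_simps)

lemmas bounded_linear_scaleC = bounded_bilinear.bounded_linear_right[OF bounded_bilinear_scaleC]

lemma scaleC_diff_right: "c *\<^sub>C (z - w) = c *\<^sub>C z - c *\<^sub>C w"
  by (rule complexification_eqI) (simp_all add: algebra_simps)

lemma scaleC_scaleR: "c *\<^sub>C (r *\<^sub>R z) = r *\<^sub>R (c *\<^sub>C z)"
  by (rule complexification_eqI) (simp_all add: algebra_simps)

text \<open>Measures how far an inequality between real parts is from holding. Being sublinear, it
  carries approximate order inequalities through sums and integrals.\<close>

definition rneg :: "'a :: banach_lattice complexification \<Rightarrow> real"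
  where "rneg z = norm (pprt (- real_part z))"

text \<open>A sublinear functional equivalent to the distance from the positive cone.\<close>

definition defect :: "'a :: banach_lattice complexification \<Rightarrow> real"
  where "defect z = rneg z + norm (imag_part z)"

lemma rneg_nonneg [simp]: "0 \<le> rneg z"
  by (simp add: rneg_def)

lemma rneg_le_defect: "rneg z \<le> defect z"
  by (simp add: defect_def)

lemma rneg_add_le: "rneg (z + w) \<le> rneg z + rneg w"
proof -
  have "pprt (- real_part (z + w)) \<le> pprt (- real_part z) + pprt (- real_part w)"
    using pprt_add_le[of "- real_part z" "- real_part w"] by simp
  then have "rneg (z + w) \<le> norm (pprt (- real_part z) + pprt (- real_part w))"
    unfolding rneg_def by (intro norm_mono_nonneg zero_le_pprt)
  then show ?thesis unfolding rneg_def using norm_triangle_ineq order_trans by blast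
qed

lemma rneg_scaleR_le:
  assumes "0 \<le> r"
  shows "rneg (r *\<^sub>R z) \<le> r * rneg z"
proof -
  have "rneg (r *\<^sub>R z) \<le> norm (r *\<^sub>R pprt (- real_part z))"
    unfolding rneg_def
  proof (rule norm_pprt_le)
    have "r *\<^sub>R (- real_part z) \<le> r *\<^sub>R pprt (- real_part z)"
      using assms by (intro scaleR_left_mono le_pprt)
    then show "- real_part (r *\<^sub>R z) \<le> r *\<^sub>R pprt (- real_part z)" by simp
  qed (simp add: assms scaleR_nonneg_nonneg)
  then show ?thesis using assms by (simp add: rneg_def)
qed

lemma rneg_le_norm: "rneg z \<le> norm z"
proof -
  have "rneg z \<le> norm \<bar>real_part z\<bar>"
    unfolding rneg_def by (intro norm_pprt_le) (simp_all add: abs_ge_minus_self)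
  then show ?thesis using norm_real_part_le[of z] by simp
qed

text \<open>Multiplication by \<open>c\<close> moves the imaginary part into the real part with an
  uncontrolled sign, which is why the right side has \<open>defect\<close> instead of
  \<open>rneg\<close>.\<close>

lemma rneg_scaleC_le:
  assumes "0 \<le> Re c"
  shows "rneg (c *\<^sub>C z) \<le> cmod c * defect z"
proof -
  have "rneg (c *\<^sub>C z) \<le> norm (Re c *\<^sub>R pprt (- real_part z) + \<bar>Im c\<bar> *\<^sub>R \<bar>imag_part z\<bar>)"
    unfolding rneg_def
  proof (rule norm_pprt_le)
    have "Re c *\<^sub>R (- real_part z) + Im c *\<^sub>R imag_part z
        \<le> Re c *\<^sub>R pprt (- real_part z) + \<bar>Im c\<bar> *\<^sub>R \<bar>imag_part z\<bar>"
      using assms by (intro add_mono scaleR_left_mono le_pprt scaleR_le_abs)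
    then show "- real_part (c *\<^sub>C z)
        \<le> Re c *\<^sub>R pprt (- real_part z) + \<bar>Im c\<bar> *\<^sub>R \<bar>imag_part z\<bar>"
      by simp
  qed (use assms in \<open>auto intro!: add_nonneg_nonneg scaleR_nonneg_nonneg\<close>)
  also have "\<dots> \<le> norm (Re c *\<^sub>R pprt (- real_part z)) + norm (\<bar>Im c\<bar> *\<^sub>R \<bar>imag_part z\<bar>)"
    by (rule norm_triangle_ineq)
  also have "\<dots> = \<bar>Re c\<bar> * rneg z + \<bar>Im c\<bar> * norm (imag_part z)"
    by (simp add: rneg_def)
  also have "\<dots> \<le> cmod c * rneg z + cmod c * norm (imag_part z)"
    by (intro add_mono mult_right_mono abs_Re_le_cmod abs_Im_le_cmod) simp_all
  finally show ?thesis by (simp add: defect_def distrib_left)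
qed

lemma defect_nonneg [simp]: "0 \<le> defect z"
  by (simp add: defect_def)

lemma defect_add_le: "defect (z + w) \<le> defect z + defect w"
  using rneg_add_le[of z w] norm_triangle_ineq[of "imag_part z" "imag_part w"]
  by (simp add: defect_def)

lemma defect_scaleR_le: "0 \<le> r \<Longrightarrow> defect (r *\<^sub>R z) \<le> r * defect z"
  using rneg_scaleR_le[of r z] by (simp add: defect_def distrib_left)

lemma defect_le_norm: "defect z \<le> 2 * norm z"
  using rneg_le_norm[of z] norm_imag_part_le[of z] by (simp add: defect_def)

lemma defect_positive [simp]: "0 \<le> p \<Longrightarrow> defect (Cx p 0) = 0"
  by (simp add: defect_def rneg_def)

text \<open>\<open>defect\<close> vanishes on the cone, is subadditive and is at most twice the
  norm, so it can be compared with each point of the cone.\<close>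

lemma defect_le_infdist: "defect z \<le> 2 * infdist z positive_cone"
proof -
  have ne: "positive_cone \<noteq> ({} :: 'a complexification set)" by (auto simp: positive_cone_def)
  have "defect z / 2 \<le> infdist z positive_cone"
    unfolding infdist_notempty[OF ne]
  proof (rule cINF_greatest[OF ne])
    fix p :: "'a complexification" assume "p \<in> positive_cone"
    then have "defect p = 0" by (auto simp: positive_cone_def)
    moreover have "defect z \<le> defect p + defect (z - p)" using defect_add_le[of p "z - p"] by simp
    ultimately show "defect z / 2 \<le> dist z p"
      using defect_le_norm[of "z - p"] by (simp add: dist_norm)
  qed
  then show ?thesis by simp
qed

section \<open>Sublinear functionals of sums and integrals\<close>

lemma sublinear_sum_le:
  fixes \<nu> :: "'b :: real_vector \<Rightarrow> real"
  assumes "\<And>x y. \<nu> (x + y) \<le> \<nu> x + \<nu> y" "\<nu> 0 \<le> 0"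
  shows "\<nu> (\<Sum>i\<in>I. x i) \<le> (\<Sum>i\<in>I. \<nu> (x i))"
proof (induction I rule: infinite_finite_induct)
  case (insert i I)
  then show ?case using assms(1)[of "x i" "sum x I"] by simp
qed (use assms in auto)

text \<open>Riemann sums over fine tagged divisions satisfy the bound by sublinearity, and the bound
  by a multiple of the norm controls their difference from the integral.\<close>

lemma sublinear_integral_le:
  fixes \<nu> :: "'b :: banach \<Rightarrow> real" and f :: "real \<Rightarrow> 'b"
  assumes add: "\<And>x y. \<nu> (x + y) \<le> \<nu> x + \<nu> y"
    and scale: "\<And>r x. 0 \<le> r \<Longrightarrow> \<nu> (r *\<^sub>R x) \<le> r * \<nu> x"
    and bound: "\<And>x. \<nu> x \<le> C * norm x"
    and f: "f integrable_on {a..b}" and ab: "a \<le> b"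
    and le: "\<And>t. t \<in> {a..b} \<Longrightarrow> \<nu> (f t) \<le> \<kappa>"
  shows "\<nu> (integral {a..b} f) \<le> (b - a) * \<kappa>"
proof (rule field_le_epsilon)
  fix e :: real assume e: "0 < e"
  \<comment> \<open>A strictly positive majorant of \<open>C\<close> makes \<open>e / C'\<close> an
    admissible tolerance.\<close>
  define C' where "C' = \<bar>C\<bar> + 1"
  have C': "0 < C'" by (simp add: C'_def)
  have bound': "\<nu> x \<le> C' * norm x" for x
  proof -
    have "C * norm x \<le> C' * norm x" by (intro mult_right_mono) (auto simp: C'_def)
    with bound[of x] show ?thesis by linarith
  qed
  have \<nu>0: "\<nu> 0 \<le> 0" using bound[of 0] by simp
  define I where "I = integral {a..b} f"
  have "(f has_integral I) (cbox a b)" using f by (simp add: I_def has_integral_integral[symmetric])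
  then obtain \<gamma> where \<gamma>: "gauge \<gamma>" "\<And>\<D>. \<D> tagged_division_of cbox a b \<Longrightarrow> \<gamma> fine \<D> \<Longrightarrow>
      norm ((\<Sum>(x, k)\<in>\<D>. measure lborel k *\<^sub>R f x) - I) < e / C'"
    using e C' unfolding has_integral by (meson divide_pos_pos)
  obtain \<D> where \<D>: "\<D> tagged_division_of cbox a b" "\<gamma> fine \<D>"
    using fine_division_exists[OF \<gamma>(1)] by blast
  define S where "S = (\<Sum>(x, k)\<in>\<D>. measure lborel k *\<^sub>R f x)"
  have "\<nu> S \<le> (\<Sum>z\<in>\<D>. \<nu> (case z of (x, k) \<Rightarrow> measure lborel k *\<^sub>R f x))"
    unfolding S_def using add \<nu>0 by (rule sublinear_sum_le)
  also have "\<dots> \<le> (\<Sum>z\<in>\<D>. case z of (x, k) \<Rightarrow> measure lborel k * \<kappa>)"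
  proof (rule sum_mono, clarify)
    fix x k assume xk: "(x, k) \<in> \<D>"
    have "x \<in> {a..b}" using \<D>(1) xk by (metis cbox_interval subsetD tagged_division_ofD(2,3))
    then have "measure lborel k * \<nu> (f x) \<le> measure lborel k * \<kappa>" by (intro mult_left_mono le) simp_all
    then show "\<nu> (measure lborel k *\<^sub>R f x) \<le> measure lborel k * \<kappa>"
      using scale[of "measure lborel k" "f x"] by simp
  qed
  also have "\<dots> = (\<Sum>(x, k)\<in>\<D>. measure lborel k) * \<kappa>"
    by (simp add: sum_distrib_right case_prod_unfold)
  also have "\<dots> = (b - a) * \<kappa>"
    using additive_content_tagged_division[OF \<D>(1)] ab by simp
  finally have "\<nu> S \<le> (b - a) * \<kappa>" .
  moreover have "\<nu> (I - S) \<le> e"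
  proof -
    have "\<nu> (I - S) \<le> C' * norm (I - S)" by (rule bound')
    also have "\<dots> \<le> C' * (e / C')"
      using \<gamma>(2)[OF \<D>] C' by (intro mult_left_mono) (auto simp: S_def norm_minus_commute)
    finally show ?thesis using C' by simp
  qed
  ultimately show "\<nu> (integral {a..b} f) \<le> (b - a) * \<kappa> + e"
    using add[of S "I - S"] by (simp add: I_def)
qed

lemma defect_integral_le:
  fixes f :: "real \<Rightarrow> 'a :: banach_lattice complexification"
  assumes "f integrable_on {a..b}" "a \<le> b" "\<And>t. t \<in> {a..b} \<Longrightarrow> defect (f t) \<le> \<kappa>"
  shows "defect (integral {a..b} f) \<le> (b - a) * \<kappa>"
  by (rule sublinear_integral_le[OF defect_add_le defect_scaleR_le defect_le_norm assms])

lemma rneg_integral_le: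
  fixes f :: "real \<Rightarrow> 'a :: banach_lattice complexification"
  assumes "f integrable_on {a..b}" "a \<le> b" "\<And>t. t \<in> {a..b} \<Longrightarrow> rneg (f t) \<le> \<kappa>"
  shows "rneg (integral {a..b} f) \<le> (b - a) * \<kappa>"
proof -
  have bound: "rneg x \<le> 1 * norm x" for x :: "'a complexification"
    using rneg_le_norm[of x] by simp
  show ?thesis
    by (rule sublinear_integral_le[OF rneg_add_le rneg_scaleR_le bound assms])
qed

section \<open>Powers of unit complex numbers and sums of moduli\<close>

text \<open>On the unit circle |1 - u|^2 = 2 (1 - Re u), so the claim is the square of |1 - z^m|
  \<le> m |1 - z|.\<close>

lemma one_minus_Re_power_le:
  assumes "cmod z = 1"
  shows "1 - Re (z ^ m) \<le> (real m)\<^sup>2 * (1 - Re z)"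
proof -
  have sq: "(cmod (1 - u))\<^sup>2 = 2 * (1 - Re u)" if "cmod u = 1" for u
  proof -
    have "(Re u)\<^sup>2 + (Im u)\<^sup>2 = 1" using that by (simp add: cmod_def)
    then show ?thesis unfolding cmod_power2 by (simp add: power2_eq_square algebra_simps)
  qed
  have "cmod (1 ^ m - z ^ m) \<le> m * cmod (1 - z)"
    using assms by (intro norm_power_diff) auto
  then have "(cmod (1 - z ^ m))\<^sup>2 \<le> (m * cmod (1 - z))\<^sup>2"
    by (intro power_mono) simp_all
  then have "2 * (1 - Re (z ^ m)) \<le> (real m)\<^sup>2 * (2 * (1 - Re z))"
    using sq[OF assms] sq[of "z ^ m"] assms by (simp only: norm_power power_mult_distrib power_one)
  also have "\<dots> = 2 * ((real m)\<^sup>2 * (1 - Re z))" by simp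
  finally show ?thesis by (simp only: mult_le_cancel_left_pos zero_less_numeral)
qed

text \<open>Negative exponents reduce to positive ones, since the inverse of \<open>z\<close> is its
  conjugate and has the same real part.\<close>

lemma one_minus_Re_power_int_le:
  assumes "cmod z = 1"
  shows "1 - Re (z powi n) \<le> (real_of_int n)\<^sup>2 * (1 - Re z)"
proof (cases "0 \<le> n")
  case True
  then show ?thesis using one_minus_Re_power_le[OF assms, of "nat n"] by (simp add: power_int_def)
next
  case False
  have "z * cnj z = 1" using complex_norm_square[of z] assms by simp
  then have "inverse z = cnj z" by (rule inverse_unique)
  then have "Re (inverse z) = Re z" "cmod (inverse z) = 1" using assms by simp_all
  then show ?thesis using one_minus_Re_power_le[of "inverse z" "nat (- n)"] False
    by (simp add: power_int_def)
qed

lemma modulus_Cx_real [simp]: "0 \<le> x \<Longrightarrow> modulus (Cx x 0) = x"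
  using modulus_le[of "Cx x 0"] abs_real_part_le_modulus[of "Cx x 0"]
  by (intro order.antisym) simp_all

lemma modulus_sum_le: "modulus (\<Sum>i\<in>I. z i) \<le> (\<Sum>i\<in>I. modulus (z i))"
proof (induction I rule: infinite_finite_induct)
  case (insert i I)
  then show ?case using order_trans[OF modulus_triangle add_left_mono] by simp
qed simp_all

section \<open>Bounded strongly continuous semigroups\<close>

locale bounded_c0_semigroup =
  fixes U :: "real \<Rightarrow> 'a :: banach_lattice complexification \<Rightarrow> 'a complexification" and M :: real
  assumes bounded_linear: "0 \<le> t \<Longrightarrow> bounded_linear (U t)"
    and scaleC: "0 \<le> t \<Longrightarrow> U t (c *\<^sub>C f) = c *\<^sub>C U t f"
    and zero: "U 0 f = f"
    and add: "0 \<le> s \<Longrightarrow> 0 \<le> t \<Longrightarrow> U (s + t) f = U s (U t f)"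
    and continuous_0: "((\<lambda>t. U t f) \<longlongrightarrow> f) (at_right 0)"
    and bound: "0 \<le> t \<Longrightarrow> norm (U t f) \<le> M * norm f"
    and M: "1 \<le> M"
begin

lemma linear: "0 \<le> t \<Longrightarrow> linear (U t)"
  by (rule bounded_linear.linear[OF bounded_linear])

lemma bound_diff: "0 \<le> t \<Longrightarrow> norm (U t f - U t g) \<le> M * norm (f - g)"
  using bound[of t "f - g"] by (simp only: linear_diff[OF linear])

text \<open>Turns a right limit at 0 into a limit at \<open>t\<close>, so that both sides of
  \<open>t\<close> are treated together when orbits are shown to be continuous and
  differentiable.\<close>

lemma tendsto_abs_diff:
  "((\<lambda>y. h \<bar>y - t\<bar>) \<longlongrightarrow> l) (at (t::real) within S)" if "(h \<longlongrightarrow> l) (at_right 0)"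
proof (rule filterlim_compose[OF that])
  have "((\<lambda>y. \<bar>y - t\<bar>) \<longlongrightarrow> \<bar>t - t\<bar>) (at t within S)" by (intro tendsto_intros)
  then show "filterlim (\<lambda>y. \<bar>y - t\<bar>) (at_right 0) (at t within S)"
    by (auto simp: filterlim_at eventually_at_filter)
qed

lemma diff_le:
  assumes "0 \<le> s" "0 \<le> t"
  shows "norm (U s f - U t f) \<le> M * norm (U \<bar>s - t\<bar> f - f)"
proof (cases "s \<le> t")
  case True
  then have "U t f = U s (U (t - s) f)" using add[of s "t - s" f] assms by simp
  then show ?thesis using bound_diff[of s f "U (t - s) f"] assms True
    by (simp add: norm_minus_commute)
next
  case False
  then have "U s f = U t (U (s - t) f)" using add[of t "s - t" f] assms by simp
  then show ?thesis using bound_diff[of t "U (s - t) f" f] assms False by simp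
qed

lemma continuous_on: "continuous_on {0..} (\<lambda>t. U t f)"
  unfolding continuous_on_def
proof
  fix t :: real assume t: "t \<in> {0..}"
  have "((\<lambda>y. M * norm (U \<bar>y - t\<bar> f - f)) \<longlongrightarrow> M * norm (f - f)) (at t within {0..})"
    by (intro tendsto_intros tendsto_abs_diff continuous_0)
  then have lim: "((\<lambda>y. M * norm (U \<bar>y - t\<bar> f - f)) \<longlongrightarrow> 0) (at t within {0..})" by simp
  have "\<forall>\<^sub>F y in at t within {0..}. norm (U y f - U t f) \<le> M * norm (U \<bar>y - t\<bar> f - f)"
    unfolding eventually_at_filter by (intro always_eventually allI impI diff_le) (use t in auto)
  then have "((\<lambda>y. U y f - U t f) \<longlongrightarrow> 0) (at t within {0..})"
    by (rule Lim_null_comparison[OF _ lim])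
  then show "((\<lambda>t. U t f) \<longlongrightarrow> U t f) (at t within {0..})" by (simp add: LIM_zero_iff)
qed

text \<open>The graph of the generator. As a relation it avoids naming the limit by
  \<open>Lim\<close>.\<close>

definition generates :: "'a complexification \<Rightarrow> 'a complexification \<Rightarrow> bool"
  where "generates f g \<longleftrightarrow> ((\<lambda>h. (U h f - f) /\<^sub>R h) \<longlongrightarrow> g) (at_right 0)"

lemma has_vector_derivative:
  assumes "generates f g" "0 \<le> t"
  shows "((\<lambda>t. U t f) has_vector_derivative U t g) (at t within {0..})"
proof -
  define D where "D h = (U h f - f) /\<^sub>R h" for h
  \<comment> \<open>Factoring out \<open>U\<close> at the smaller of \<open>y\<close> and
    \<open>t\<close> leaves the difference quotient at the positive step |y - t|, on either side of
    \<open>t\<close>. The price is \<open>min y t\<close> in place of \<open>t\<close>, which strong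
    continuity absorbs.\<close>
  have step: "norm (U y f - U t f - (y - t) *\<^sub>R U t g) / norm (y - t)
      \<le> M * norm (D \<bar>y - t\<bar> - g) + norm (U (min y t) g - U t g)"
    if y: "0 \<le> y" "y \<noteq> t" for y
  proof -
    define s where "s = min y t"
    define h where "h = \<bar>y - t\<bar>"
    have sh: "0 \<le> s" "0 < h" using y assms(2) by (auto simp: s_def h_def)
    have lin: "U s (x - x') = U s x - U s x'" "U s (r *\<^sub>R x) = r *\<^sub>R U s x" for x x' r
      by (rule linear_diff[OF linear[OF sh(1)]] linear_scale[OF linear[OF sh(1)]])+
    have "h *\<^sub>R U s (D h) = U s (U h f) - U s f" using sh by (simp add: D_def lin)
    moreover have "U (s + h) f = U s (U h f)" using sh by (simp add: add)
    moreover have "s = y \<and> s + h = t \<and> y - t = - h \<or> s = t \<and> s + h = y \<and> y - t = h"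
      by (auto simp: s_def h_def)
    ultimately have "U y f - U t f = (y - t) *\<^sub>R U s (D h)" by auto
    then have "U y f - U t f - (y - t) *\<^sub>R U t g = (y - t) *\<^sub>R (U s (D h) - U t g)"
      by (simp add: scaleR_diff_right)
    then have "norm (U y f - U t f - (y - t) *\<^sub>R U t g) / norm (y - t) = norm (U s (D h) - U t g)"
      using y by simp
    also have "\<dots> \<le> norm (U s (D h) - U s g) + norm (U s g - U t g)"
      using norm_triangle_ineq[of "U s (D h) - U s g" "U s g - U t g"] by simp
    also have "\<dots> \<le> M * norm (D h - g) + norm (U s g - U t g)"
      using bound_diff[OF sh(1)] by simp
    finally show ?thesis by (simp add: s_def h_def)
  qed
  have "((\<lambda>y. U (min y t) g) \<longlongrightarrow> U (min t t) g) (at t within {0..})"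
  proof -
    have "continuous_on {0..} (\<lambda>y. U (min y t) g)"
      by (rule continuous_on_compose2[OF continuous_on]) (use assms(2) in \<open>auto intro!: continuous_intros\<close>)
    then show ?thesis using assms(2) unfolding continuous_on_def by (elim ballE[of _ _ t]) auto
  qed
  then have "((\<lambda>y. M * norm (D \<bar>y - t\<bar> - g) + norm (U (min y t) g - U t g))
      \<longlongrightarrow> M * norm (g - g) + norm (U (min t t) g - U t g)) (at t within {0..})"
    using assms(1) unfolding generates_def D_def[symmetric]
    by (intro tendsto_intros tendsto_abs_diff)
  then have lim: "((\<lambda>y. M * norm (D \<bar>y - t\<bar> - g) + norm (U (min y t) g - U t g)) \<longlongrightarrow> 0)
      (at t within {0..})" by simp
  have "((\<lambda>y. norm (U y f - U t f - (y - t) *\<^sub>R U t g) / norm (y - t)) \<longlongrightarrow> 0) (at t within {0..})"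
    by (rule Lim_null_comparison[OF _ lim])
      (use step assms(2) in \<open>auto simp: eventually_at_filter\<close>)
  then show ?thesis
    unfolding has_vector_derivative_def has_derivative_iff_norm
    by (simp add: bounded_linear_scaleR_left)
qed

text \<open>The rotation shifts the generator by -i \<beta>, so an eigenvector for i \<beta> becomes
  a fixed vector.\<close>

abbreviation V :: "real \<Rightarrow> real \<Rightarrow> 'a complexification \<Rightarrow> 'a complexification"
  where "V \<beta> t f \<equiv> cis (- \<beta> * t) *\<^sub>C U t f"

lemma continuous_on_V: "continuous_on {0..} (\<lambda>t. V \<beta> t f)"
  by (rule bounded_bilinear.continuous_on[OF bounded_bilinear_scaleC _ continuous_on])
    (intro continuous_intros)

lemma integrable_V: "0 \<le> a \<Longrightarrow> (\<lambda>t. V \<beta> t f) integrable_on {a..b}"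
  by (intro integrable_continuous_real continuous_on_subset[OF continuous_on_V]) auto

lemma norm_V_le: "0 \<le> t \<Longrightarrow> norm (V \<beta> t f) \<le> M * norm f"
  using bound[of t f] by (simp add: norm_scaleC)

lemma has_integral_V:
  assumes "generates f g" "0 \<le> a" "a \<le> b"
  shows "((\<lambda>t. V \<beta> t (g - (\<i> * of_real \<beta>) *\<^sub>C f)) has_integral V \<beta> b f - V \<beta> a f) {a..b}"
proof (rule fundamental_theorem_of_calculus[OF assms(3)])
  fix t assume t: "t \<in> {a..b}"
  then have t0: "0 \<le> t" using assms(2) by simp
  have "((\<lambda>t. cis (- \<beta> * t)) has_vector_derivative (- (\<i> * of_real \<beta>) * cis (- \<beta> * t))) (at t within {a..b})"
    unfolding has_vector_derivative_def cis.ctr Complex_eq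
    by (auto intro!: derivative_eq_intros simp: fun_eq_iff scaleR_conv_of_real algebra_simps)
  moreover have "((\<lambda>t. U t f) has_vector_derivative U t g) (at t within {a..b})"
    by (rule has_vector_derivative_within_subset[OF has_vector_derivative[OF assms(1) t0]])
      (use assms(2) in auto)
  ultimately have "((\<lambda>t. V \<beta> t f) has_vector_derivative
      cis (- \<beta> * t) *\<^sub>C U t g + (- (\<i> * of_real \<beta>) * cis (- \<beta> * t)) *\<^sub>C U t f) (at t within {a..b})"
    by (rule bounded_bilinear.has_vector_derivative[OF bounded_bilinear_scaleC])
  moreover have "cis (- \<beta> * t) *\<^sub>C U t g + (- (\<i> * of_real \<beta>) * cis (- \<beta> * t)) *\<^sub>C U t f
      = V \<beta> t (g - (\<i> * of_real \<beta>) *\<^sub>C f)"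
  proof -
    have "U t (g - (\<i> * of_real \<beta>) *\<^sub>C f) = U t g - (\<i> * of_real \<beta>) *\<^sub>C U t f"
      by (simp only: linear_diff[OF linear[OF t0]] scaleC[OF t0])
    then show ?thesis by (simp only:) (rule complexification_eqI; simp add: algebra_simps)
  qed
  ultimately show "((\<lambda>t. V \<beta> t f) has_vector_derivative V \<beta> t (g - (\<i> * of_real \<beta>) *\<^sub>C f))
      (at t within {a..b})" by (simp only:)
qed

text \<open>If i \<beta> is in the resolvent set, every vector is the image of some \<open>f\<close>
  of controlled norm. The integral of its rotated orbit is then bounded independently of the
  interval, so averages over long intervals are small.\<close>

lemma norm_integral_V_le:
  assumes "generates f g" "0 \<le> a" "a \<le> b"
  shows "norm (integral {a..b} (\<lambda>t. V \<beta> t ((\<i> * of_real \<beta>) *\<^sub>C f - g))) \<le> 2 * M * norm f"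
proof -
  have "((\<lambda>t. - V \<beta> t (g - (\<i> * of_real \<beta>) *\<^sub>C f)) has_integral - (V \<beta> b f - V \<beta> a f)) {a..b}"
    by (intro has_integral_neg has_integral_V assms)
  moreover have "- V \<beta> t (g - (\<i> * of_real \<beta>) *\<^sub>C f) = V \<beta> t ((\<i> * of_real \<beta>) *\<^sub>C f - g)"
    if "t \<in> {a..b}" for t
  proof -
    have "U t (- (g - (\<i> * of_real \<beta>) *\<^sub>C f)) = - U t (g - (\<i> * of_real \<beta>) *\<^sub>C f)"
      using assms(2) that by (intro linear_neg linear) auto
    then have "U t ((\<i> * of_real \<beta>) *\<^sub>C f - g) = - U t (g - (\<i> * of_real \<beta>) *\<^sub>C f)" by simp
    then show ?thesis by (simp only:) (rule complexification_eqI; simp)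
  qed
  ultimately have "((\<lambda>t. V \<beta> t ((\<i> * of_real \<beta>) *\<^sub>C f - g)) has_integral - (V \<beta> b f - V \<beta> a f)) {a..b}"
    by (rule has_integral_eq[rotated])
  then have "norm (integral {a..b} (\<lambda>t. V \<beta> t ((\<i> * of_real \<beta>) *\<^sub>C f - g))) = norm (- (V \<beta> b f - V \<beta> a f))"
    by (simp only: integral_unique)
  also have "\<dots> = norm (V \<beta> b f - V \<beta> a f)"
    by (rule norm_minus_cancel)
  also have "\<dots> \<le> M * norm f + M * norm f"
    using assms(2,3) by (intro order_trans[OF norm_triangle_ineq4] add_mono norm_V_le) auto
  finally show ?thesis by simp
qed

text \<open>An approximate eigenvector for i \<beta> is thus almost fixed by
  \<open>V \<beta> t\<close> over any time span prescribed in advance.\<close>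

lemma norm_V_diff_le:
  assumes "generates f g" "0 \<le> t"
  shows "norm (V \<beta> t f - f) \<le> t * (M * norm (g - (\<i> * of_real \<beta>) *\<^sub>C f))"
proof -
  have "V \<beta> t f - f = integral {0..t} (\<lambda>t. V \<beta> t (g - (\<i> * of_real \<beta>) *\<^sub>C f))"
    using integral_unique[OF has_integral_V[OF assms(1) order_refl assms(2)], of \<beta>] by (simp add: zero)
  also have "norm \<dots> \<le> (M * norm (g - (\<i> * of_real \<beta>) *\<^sub>C f)) * (t - 0)"
    using assms(2) by (intro integral_bound continuous_on_subset[OF continuous_on_V] norm_V_le) auto
  finally show ?thesis by (simp add: mult_ac)
qed

section \<open>Time averages\<close>

lemma integrable_U: "0 \<le> a \<Longrightarrow> (\<lambda>t. U t f) integrable_on {a..b}"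
  by (intro integrable_continuous_real continuous_on_subset[OF continuous_on]) auto

text \<open>In the application the window starts at a time \<open>a\<close> after which the
  semigroup is positive up to the current tolerance.\<close>

definition avg :: "real \<Rightarrow> real \<Rightarrow> 'a complexification \<Rightarrow> 'a complexification"
  where "avg a L f = (1 / L) *\<^sub>R integral {a..a + L} (\<lambda>t. U t f)"

lemma linear_avg:
  assumes "0 \<le> a"
  shows "linear (avg a L)"
proof (rule linearI)
  fix f g :: "'a complexification" and r :: real
  have "integral {a..a + L} (\<lambda>t. U t (f + g)) = integral {a..a + L} (\<lambda>t. U t f + U t g)"
    using assms by (intro integral_cong linear_add linear) simp
  then show "avg a L (f + g) = avg a L f + avg a L g"
    using assms by (simp add: avg_def integral_add integrable_U scaleR_right_distrib)
  have "integral {a..a + L} (\<lambda>t. U t (r *\<^sub>R f)) = integral {a..a + L} (\<lambda>t. r *\<^sub>R U t f)"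
    using assms by (intro integral_cong linear_scale linear) simp
  then show "avg a L (r *\<^sub>R f) = r *\<^sub>R avg a L f"
    by (simp add: avg_def)
qed

text \<open>As \<open>U s\<close> passes under the integral, a bound on a whole orbit is inherited
  by the orbit of the average. Iteration gives the same constant \<open>M\<close> for all powers of
  the average, where multiplying operator norms would give powers of \<open>M\<close>.\<close>

lemma norm_U_avg_le:
  assumes "0 \<le> a" "0 < L" "\<And>s. 0 \<le> s \<Longrightarrow> norm (U s f) \<le> c" "0 \<le> s"
  shows "norm (U s (avg a L f)) \<le> c"
proof -
  have "U s (integral {a..a + L} (\<lambda>t. U t f)) = integral {a..a + L} (U s \<circ> (\<lambda>t. U t f))"
    by (rule integral_linear[symmetric, OF integrable_U[OF assms(1)] bounded_linear[OF assms(4)]])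
  also have "\<dots> = integral {a..a + L} (\<lambda>t. U (s + t) f)"
    using assms by (intro integral_cong) (simp add: add)
  finally have "U s (integral {a..a + L} (\<lambda>t. U t f)) = integral {a..a + L} (\<lambda>t. U (s + t) f)" .
  moreover have "norm (integral {a..a + L} (\<lambda>t. U (s + t) f)) \<le> c * (a + L - a)"
  proof (rule integral_bound)
    show "continuous_on {a..a + L} (\<lambda>t. U (s + t) f)"
      by (rule continuous_on_compose2[OF continuous_on])
        (use assms in \<open>auto intro!: continuous_intros\<close>)
  qed (use assms in auto)
  ultimately have "norm (U s (integral {a..a + L} (\<lambda>t. U t f))) \<le> c * L" by simp
  moreover have "U s (avg a L f) = (1 / L) *\<^sub>R U s (integral {a..a + L} (\<lambda>t. U t f))"
    unfolding avg_def by (rule linear_scale[OF linear[OF assms(4)]])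
  ultimately show ?thesis using assms(2) by (simp add: field_simps)
qed

lemma norm_avg_power_le:
  assumes "0 \<le> a" "0 < L"
  shows "norm ((avg a L ^^ i) f) \<le> M * norm f"
proof -
  have "norm (U s ((avg a L ^^ i) f)) \<le> M * norm f" if "0 \<le> s" for s
    using that
  proof (induction i arbitrary: s)
    case 0
    then show ?case using bound by simp
  next
    case (Suc i)
    then show ?case using assms by (simp add: norm_U_avg_le)
  qed
  from this[of 0] show ?thesis by (simp add: zero)
qed

lemma defect_avg_le_of_le:
  assumes "0 \<le> a" "0 < L" "\<And>t. a \<le> t \<Longrightarrow> defect (U t f) \<le> \<kappa>"
  shows "defect (avg a L f) \<le> \<kappa>"
proof -
  have "defect (avg a L f) \<le> (1 / L) * defect (integral {a..a + L} (\<lambda>t. U t f))"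
    unfolding avg_def using assms(2) by (intro defect_scaleR_le) simp
  also have "\<dots> \<le> (1 / L) * ((a + L - a) * \<kappa>)"
    using assms by (intro mult_left_mono defect_integral_le integrable_U) auto
  finally show ?thesis using assms(2) by simp
qed

text \<open>\<open>x\<close> is split into the positive part of its real part, which the average
  keeps almost positive, and a rest of norm at most \<open>defect x\<close>, for which only the norm
  bound is used.\<close>

lemma defect_avg_le:
  assumes "0 \<le> a" "0 < L" and \<tau>: "0 \<le> \<tau>"
    and pos: "\<And>t p. a \<le> t \<Longrightarrow> 0 \<le> p \<Longrightarrow> defect (U t (Cx p 0)) \<le> \<tau> * norm p"
  shows "defect (avg a L x) \<le> \<tau> * norm x + 2 * M * defect x"
proof -
  define p where "p = pprt (real_part x)"
  define r where "r = Cx (- pprt (- real_part x)) (imag_part x)"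
  have "real_part x = p + - pprt (- real_part x)"
    using prts[of "real_part x"] by (simp add: p_def pprt_neg)
  then have x: "x = Cx p 0 + r"
    by (intro complexification_eqI) (simp_all add: r_def)
  have p: "norm p \<le> norm x"
  proof -
    have "norm p \<le> norm \<bar>real_part x\<bar>" unfolding p_def by (intro norm_pprt_le) (simp_all add: abs_ge_self)
    then show ?thesis using norm_real_part_le[of x] by simp
  qed
  have r: "norm r \<le> defect x"
  proof -
    have "norm r \<le> norm (pprt (- real_part x) + \<bar>imag_part x\<bar>)"
      unfolding norm_modulus[symmetric, of r]
      using modulus_le[of r] by (intro norm_mono_nonneg) (simp_all add: r_def)
    also have "\<dots> \<le> defect x"
      using norm_triangle_ineq[of "pprt (- real_part x)" "\<bar>imag_part x\<bar>"]
      by (simp add: defect_def rneg_def)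
    finally show ?thesis .
  qed
  have "defect (avg a L x) \<le> defect (avg a L (Cx p 0)) + defect (avg a L r)"
    unfolding x linear_add[OF linear_avg[OF assms(1)]] by (rule defect_add_le)
  also have "defect (avg a L (Cx p 0)) \<le> \<tau> * norm p"
    using assms by (intro defect_avg_le_of_le) (auto simp: p_def)
  also have "defect (avg a L r) \<le> 2 * norm (avg a L r)" by (rule defect_le_norm)
  also have "norm (avg a L r) \<le> M * norm r" using norm_avg_power_le[OF assms(1,2), of 1 r] by simp
  finally have "defect (avg a L x) \<le> \<tau> * norm p + 2 * (M * norm r)" by simp
  also have "\<dots> \<le> \<tau> * norm x + 2 * (M * defect x)"
    using p r \<tau> M by (intro add_mono mult_left_mono) auto
  finally show ?thesis by simp
qed

text \<open>Iterating \<open>h \<le> q P h\<close> with \<open>P = avg a L\<close> gives \<open>h \<le> q\<^sup>j P\<^sup>j h\<close>, and the powers of \<open>P\<close>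
  are bounded by \<open>M\<close>.\<close>

lemma rneg_avg_gt:
  assumes q: "0 \<le> q" "q < 1"
  shows "\<exists>\<tau>>0. \<forall>h a L. 0 \<le> h \<longrightarrow> norm h = 1 \<longrightarrow> 0 \<le> a \<longrightarrow> 0 < L \<longrightarrow>
    (\<forall>t p. a \<le> t \<longrightarrow> 0 \<le> p \<longrightarrow> defect (U t (Cx p 0)) \<le> \<tau> * norm p) \<longrightarrow>
    \<tau> < rneg (q *\<^sub>R avg a L (Cx h 0) - Cx h 0)"
proof -
  have "(\<lambda>j. q ^ j * M) \<longlonglongrightarrow> 0 * M" using q by (intro tendsto_intros LIMSEQ_realpow_zero) auto
  then have "\<forall>\<^sub>F j in sequentially. q ^ j * M < 1 / 2" by (rule order_tendstoD(2)) simp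
  \<comment> \<open>The number of iterations depends only on \<open>q\<close> and \<open>M\<close>,
    so that \<tau> can be fixed before \<open>h\<close>, \<open>a\<close> and
    \<open>L\<close>.\<close>
  then obtain j where j: "q ^ j * M < 1 / 2" by (auto simp: eventually_sequentially)
  \<comment> \<open>\<open>A\<close> is large enough to absorb both error terms of one application
    of the average into a single factor; \<tau> below keeps the total error
    \<open>real j * A ^ j * \<tau>\<close> at most 1/2.\<close>
  define A where "A = 4 * M\<^sup>2"
  have MM: "M \<le> M\<^sup>2" "1 \<le> M\<^sup>2" using M by (simp_all add: power2_eq_square mult_ge1_I)
  then have A: "4 \<le> A" "2 * M \<le> A / 2" "2 * M\<^sup>2 \<le> A / 2" by (simp_all add: A_def)
  have Ai: "1 \<le> A ^ i" for i using A by simp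
  define \<tau> where "\<tau> = 1 / (2 * (real j + 1) * A ^ j)"
  have \<tau>: "0 < \<tau>" using A by (simp add: \<tau>_def)
  have "\<tau> < rneg (q *\<^sub>R avg a L (Cx h 0) - Cx h 0)"
    if h: "0 \<le> h" "norm h = 1" and aL: "0 \<le> a" "0 < L"
      and pos: "\<forall>t p. a \<le> t \<longrightarrow> 0 \<le> p \<longrightarrow> defect (U t (Cx p 0)) \<le> \<tau> * norm p" for h a L
  proof (rule ccontr)
    assume "\<not> ?thesis"
    then have r: "rneg (q *\<^sub>R avg a L (Cx h 0) - Cx h 0) \<le> \<tau>" by simp
    define P where "P = avg a L"
    define y where "y = q *\<^sub>R P (Cx h 0) - Cx h 0"
    have linP: "linear (P ^^ i)" for i
    proof (induction i)
      case 0
      show ?case by (simp add: linear_iff)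
    next
      case (Suc i)
      from linear_compose[OF this linear_avg[OF aL(1)]] show ?case by (simp only: P_def funpow.simps)
    qed
    have defP: "defect (P x) \<le> \<tau> * norm x + 2 * M * defect x" for x
      unfolding P_def using aL \<tau> pos by (intro defect_avg_le) auto
    have normP: "norm ((P ^^ i) x) \<le> M * norm x" for i x
      unfolding P_def by (rule norm_avg_power_le[OF aL])
    have y: "norm y \<le> 2 * M"
    proof -
      have "norm (q *\<^sub>R P (Cx h 0)) \<le> 1 * M"
        using normP[of 1 "Cx h 0"] h q M mult_mono[of q 1 "norm (P (Cx h 0))" M] by simp
      then show ?thesis using norm_triangle_ineq4[of "q *\<^sub>R P (Cx h 0)" "Cx h 0"] h M
        by (simp add: y_def)
    qed
    have D: "defect ((P ^^ i) y) \<le> A ^ Suc i * \<tau>" for i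
    proof (induction i)
      case 0
      \<comment> \<open>The assumption \<open>r\<close> concerns only the real part of
        \<open>y\<close>. The imaginary part comes from \<open>P\<close> applied to the positive
        vector \<open>h\<close>, whose defect is 0.\<close>
      have "norm (imag_part y) \<le> norm (imag_part (P (Cx h 0)))"
        using q by (auto simp: y_def intro!: mult_left_le_one_le)
      also have "\<dots> \<le> defect (P (Cx h 0))" by (simp add: defect_def)
      also have "\<dots> \<le> \<tau>" using defP[of "Cx h 0"] h by simp
      finally have "defect y \<le> \<tau> + \<tau>"
        unfolding defect_def using r by (intro add_mono) (auto simp: y_def P_def)
      also have "\<dots> \<le> A * \<tau>" using mult_right_mono[OF A(1), of \<tau>] \<tau> by simp
      finally show ?case by simp
    next
      case (Suc i)
      have "defect ((P ^^ Suc i) y) \<le> \<tau> * norm ((P ^^ i) y) + 2 * M * defect ((P ^^ i) y)"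
        using defP[of "(P ^^ i) y"] by simp
      also have "\<dots> \<le> \<tau> * (M * (2 * M)) + 2 * M * (A ^ Suc i * \<tau>)"
        using Suc \<tau> M order_trans[OF normP mult_left_mono[OF y, of M], of i]
        by (intro add_mono mult_left_mono) auto
      also have "\<dots> = (2 * M\<^sup>2 + 2 * M * A ^ Suc i) * \<tau>"
        by (simp add: power2_eq_square algebra_simps)
      also have "\<dots> \<le> (A / 2 * A ^ Suc i + A / 2 * A ^ Suc i) * \<tau>"
      proof (intro mult_right_mono add_mono)
        show "2 * M\<^sup>2 \<le> A / 2 * A ^ Suc i"
        proof -
          have "A / 2 * 1 \<le> A / 2 * A ^ Suc i" using A(1) by (intro mult_left_mono Ai) simp
          with A(3) show ?thesis by linarith
        qed
        show "2 * M \<le> A / 2" by (rule A)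
      qed (use \<tau> A in auto)
      finally show ?case by (simp add: field_simps)
    qed
    have "defect (q ^ i *\<^sub>R (P ^^ i) (Cx h 0) - Cx h 0) \<le> real i * A ^ i * \<tau>" for i
    proof (induction i)
      case 0
      then show ?case by (simp add: defect_def rneg_def)
    next
      case (Suc i)
      \<comment> \<open>Telescoping: each further step adds \<open>q ^ i\<close> times the
        \<open>i\<close>-th iterate of \<open>y\<close> to the error.\<close>
      have "q ^ Suc i *\<^sub>R (P ^^ Suc i) (Cx h 0) - Cx h 0
          = (q ^ i *\<^sub>R (P ^^ i) (Cx h 0) - Cx h 0) + q ^ i *\<^sub>R (P ^^ i) y"
        using linP[of i] by (simp add: y_def linear_diff linear_scale funpow_swap1 scaleR_diff_right)
      then have "defect (q ^ Suc i *\<^sub>R (P ^^ Suc i) (Cx h 0) - Cx h 0)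
          \<le> defect (q ^ i *\<^sub>R (P ^^ i) (Cx h 0) - Cx h 0) + defect (q ^ i *\<^sub>R (P ^^ i) y)"
        by (simp only: defect_add_le)
      also have "\<dots> \<le> real i * A ^ i * \<tau> + 1 * (A ^ Suc i * \<tau>)"
      proof (rule add_mono[OF Suc])
        have "defect (q ^ i *\<^sub>R (P ^^ i) y) \<le> q ^ i * defect ((P ^^ i) y)"
          using q by (intro defect_scaleR_le) simp
        also have "\<dots> \<le> 1 * (A ^ Suc i * \<tau>)"
          using q D[of i] by (intro mult_mono power_le_one) auto
        finally show "defect (q ^ i *\<^sub>R (P ^^ i) y) \<le> 1 * (A ^ Suc i * \<tau>)" .
      qed
      also have "\<dots> \<le> real i * A ^ Suc i * \<tau> + 1 * (A ^ Suc i * \<tau>)"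
        using A \<tau> by (intro add_mono mult_right_mono mult_left_mono power_increasing) auto
      finally show ?case by (simp add: algebra_simps)
    qed
    from this[of j] have d: "rneg (q ^ j *\<^sub>R (P ^^ j) (Cx h 0) - Cx h 0) \<le> real j * A ^ j * \<tau>"
      using rneg_le_defect order_trans by blast
    define e where "e = pprt (- real_part (q ^ j *\<^sub>R (P ^^ j) (Cx h 0) - Cx h 0))"
    \<comment> \<open>\<open>h\<close> lies below the contracted iterate, of norm less than 1/2,
      plus the accumulated error, of norm at most 1/2, although its own norm is 1.\<close>
    have "h \<le> real_part (q ^ j *\<^sub>R (P ^^ j) (Cx h 0)) + e"
      using le_pprt[of "- real_part (q ^ j *\<^sub>R (P ^^ j) (Cx h 0) - Cx h 0)", folded e_def]
      by (simp add: algebra_simps)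
    then have "norm h \<le> norm (real_part (q ^ j *\<^sub>R (P ^^ j) (Cx h 0)) + e)"
      using h by (intro norm_mono_nonneg)
    also have "\<dots> \<le> norm (q ^ j *\<^sub>R (P ^^ j) (Cx h 0)) + norm e"
      by (intro order_trans[OF norm_triangle_ineq] add_mono norm_real_part_le order_refl)
    also have "\<dots> \<le> q ^ j * M + real j * A ^ j * \<tau>"
      using normP[of j "Cx h 0"] h q d by (auto intro!: add_mono mult_left_mono simp: e_def rneg_def)
    also have "\<dots> < 1 / 2 + 1 / 2"
    proof (rule add_less_le_mono[OF j])
      have "real j * A ^ j * \<tau> = real j / (real j + 1) / 2"
        using A(1) by (simp add: \<tau>_def)
      then show "real j * A ^ j * \<tau> \<le> 1 / 2" by simp
    qed
    finally show False using h by simp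
  qed
  with \<tau> show ?thesis by blast
qed

section \<open>Averages of rotated orbits\<close>

text \<open>The averaged integrand is \<open>\<Sum> (K (1 - z) - (1 - z\<^sup>n)) U t w\<^sub>\<zeta>\<close> with \<open>z = cnj \<xi> \<cdot> cis (- \<beta> t) \<cdot> \<zeta>\<close>
  on the unit circle. The real parts of its coefficients are nonnegative for \<open>K = n\<^sup>2 + 1\<close>, as
  \<open>1 - cos (n \<theta>) \<le> n\<^sup>2 (1 - cos \<theta>)\<close>.\<close>

lemma rneg_rotated_le:
  fixes w :: "complex \<Rightarrow> 'a" and n :: int and K \<epsilon> \<beta> :: real
  assumes fin: "finite Z" and unit: "\<And>\<zeta>. \<zeta> \<in> Z \<Longrightarrow> cmod \<zeta> = 1" and \<xi>: "cmod \<xi> = 1"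
    and K: "K = (real_of_int n)\<^sup>2 + 1" and a: "0 \<le> a" "0 < L"
    and def: "\<And>t \<zeta>. a \<le> t \<Longrightarrow> \<zeta> \<in> Z \<Longrightarrow> defect (U t (Cx (w \<zeta>) 0)) \<le> \<epsilon>"
  shows "rneg ((K - 1) *\<^sub>R avg a L (\<Sum>\<zeta>\<in>Z. Cx (w \<zeta>) 0)
      - (of_real K * cnj \<xi>) *\<^sub>C ((1 / L) *\<^sub>R integral {a..a + L} (\<lambda>t. V \<beta> t (\<Sum>\<zeta>\<in>Z. \<zeta> *\<^sub>C Cx (w \<zeta>) 0)))
      + (cnj \<xi> powi n) *\<^sub>C ((1 / L) *\<^sub>R integral {a..a + L} (\<lambda>t. V (n * \<beta>) t (\<Sum>\<zeta>\<in>Z. (\<zeta> powi n) *\<^sub>C Cx (w \<zeta>) 0))))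
    \<le> card Z * (2 * K * \<epsilon>)"
proof -
  define h where "h = (\<Sum>\<zeta>\<in>Z. Cx (w \<zeta>) 0)"
  define f where "f = (\<Sum>\<zeta>\<in>Z. \<zeta> *\<^sub>C Cx (w \<zeta>) 0)"
  define fn where "fn = (\<Sum>\<zeta>\<in>Z. (\<zeta> powi n) *\<^sub>C Cx (w \<zeta>) 0)"
  define z where "z \<zeta> t = cnj \<xi> * cis (- \<beta> * t) * \<zeta>" for \<zeta> and t :: real
  define c where "c \<zeta> t = of_real (K - 1) - of_real K * z \<zeta> t + z \<zeta> t powi n" for \<zeta> and t :: real
  define u where "u t = (K - 1) *\<^sub>R U t h - (of_real K * cnj \<xi>) *\<^sub>C V \<beta> t f + (cnj \<xi> powi n) *\<^sub>C V (n * \<beta>) t fn" for t :: real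
  have K1: "1 \<le> K" by (simp add: K)
  have z: "cmod (z \<zeta> t) = 1" if "\<zeta> \<in> Z" for \<zeta> and t :: real
    using unit[OF that] \<xi> by (simp add: z_def norm_mult)
  have u_eq: "u t = (\<Sum>\<zeta>\<in>Z. c \<zeta> t *\<^sub>C U t (Cx (w \<zeta>) 0))" if "0 \<le> t" for t :: real
  proof -
    have lin: "linear (U t)" using that by (rule linear)
    have U_sum: "U t (\<Sum>\<zeta>\<in>Z. b \<zeta> *\<^sub>C Cx (w \<zeta>) 0) = (\<Sum>\<zeta>\<in>Z. b \<zeta> *\<^sub>C U t (Cx (w \<zeta>) 0))" for b
      by (simp only: linear_sum[OF lin] scaleC[OF that])
    have "(K - 1) *\<^sub>R U t h = (\<Sum>\<zeta>\<in>Z. of_real (K - 1) *\<^sub>C U t (Cx (w \<zeta>) 0))"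
      using U_sum[of "\<lambda>_. 1"] by (simp only: h_def scaleC_one scaleC_of_real scaleR_right.sum)
    moreover have "(of_real K * cnj \<xi>) *\<^sub>C V \<beta> t f
        = (\<Sum>\<zeta>\<in>Z. (of_real K * z \<zeta> t) *\<^sub>C U t (Cx (w \<zeta>) 0))"
      by (simp only: f_def U_sum scaleC_sum_right scaleC_scaleC z_def mult.assoc)
    moreover have "(cnj \<xi> powi n) *\<^sub>C V (n * \<beta>) t fn = (\<Sum>\<zeta>\<in>Z. (z \<zeta> t powi n) *\<^sub>C U t (Cx (w \<zeta>) 0))"
    proof -
      have "(cnj \<xi> powi n) * (cis (- (n * \<beta>) * t) * \<zeta> powi n) = z \<zeta> t powi n" for \<zeta>
      proof -
        have "cis (- (n * \<beta>) * t) = cis (- \<beta> * t) powi n"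
          by (simp add: cis_power_int mult.assoc)
        then show ?thesis by (simp only: z_def power_int_mult_distrib mult.assoc)
      qed
      then show ?thesis by (simp only: fn_def U_sum scaleC_sum_right scaleC_scaleC)
    qed
    moreover have "c \<zeta> t *\<^sub>C x = of_real (K - 1) *\<^sub>C x - (of_real K * z \<zeta> t) *\<^sub>C x + (z \<zeta> t powi n) *\<^sub>C x" for \<zeta> and x :: "'a complexification"
      unfolding c_def by (rule complexification_eqI) (simp_all add: algebra_simps)
    ultimately show ?thesis by (simp only: u_def sum.distrib sum_subtractf)
  qed
  have "rneg (u t) \<le> card Z * (2 * K * \<epsilon>)" if t: "t \<in> {a..a + L}" for t :: real
  proof -
    have t': "0 \<le> t" "a \<le> t" using t a by auto
    have "rneg (u t) \<le> (\<Sum>\<zeta>\<in>Z. rneg (c \<zeta> t *\<^sub>C U t (Cx (w \<zeta>) 0)))"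
      unfolding u_eq[OF t'(1)] by (rule sublinear_sum_le[OF rneg_add_le]) (simp add: rneg_def)
    also have "\<dots> \<le> (\<Sum>\<zeta>\<in>Z. 2 * K * \<epsilon>)"
    proof (rule sum_mono)
      fix \<zeta> assume \<zeta>: "\<zeta> \<in> Z"
      have "1 - Re (z \<zeta> t powi n) \<le> (K - 1) * (1 - Re (z \<zeta> t))"
        using one_minus_Re_power_int_le[OF z[OF \<zeta>, of t], of n] by (simp add: K)
      moreover have "Re (z \<zeta> t) \<le> 1" using complex_Re_le_cmod[of "z \<zeta> t"] z[OF \<zeta>] by simp
      ultimately have "0 \<le> Re (c \<zeta> t)" by (simp add: c_def algebra_simps)
      then have "rneg (c \<zeta> t *\<^sub>C U t (Cx (w \<zeta>) 0)) \<le> cmod (c \<zeta> t) * defect (U t (Cx (w \<zeta>) 0))"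
        by (rule rneg_scaleC_le)
      also have "\<dots> \<le> 2 * K * \<epsilon>"
      proof (rule mult_mono)
        have "cmod (c \<zeta> t) \<le> cmod (of_real (K - 1)) + cmod (of_real K * z \<zeta> t) + cmod (z \<zeta> t powi n)"
          unfolding c_def by (intro order_trans[OF norm_triangle_ineq] add_right_mono norm_triangle_ineq4)
        also have "\<dots> = 2 * K" using K1 z[OF \<zeta>, of t]
          by (simp only: norm_mult norm_of_real norm_power_int) simp
        finally show "cmod (c \<zeta> t) \<le> 2 * K" .
      qed (use def[OF t'(2) \<zeta>] K1 in auto)
      finally show "rneg (c \<zeta> t *\<^sub>C U t (Cx (w \<zeta>) 0)) \<le> 2 * K * \<epsilon>" .
    qed
    finally show ?thesis by simp
  qed
  moreover have int: "(\<lambda>t. c *\<^sub>C V \<gamma> t x) integrable_on {a..a + L}" for c \<gamma> x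
    using integrable_linear[OF integrable_V[OF a(1), of \<gamma> x "a + L"] bounded_linear_scaleC[of c]] by (simp add: o_def)
  have intU: "(\<lambda>t. (K - 1) *\<^sub>R U t h) integrable_on {a..a + L}"
    by (intro integrable_cmul integrable_U a)
  have "u integrable_on {a..a + L}"
    unfolding u_def by (intro integrable_add integrable_diff int intU)
  ultimately have "rneg (integral {a..a + L} u) \<le> (a + L - a) * (card Z * (2 * K * \<epsilon>))"
    using a by (intro rneg_integral_le) auto
  then have "rneg ((1 / L) *\<^sub>R integral {a..a + L} u) \<le> (1 / L) * (L * (card Z * (2 * K * \<epsilon>)))"
    using a by (intro order_trans[OF rneg_scaleR_le] mult_left_mono) auto
  moreover have "(1 / L) *\<^sub>R integral {a..a + L} u
      = (K - 1) *\<^sub>R avg a L h - (of_real K * cnj \<xi>) *\<^sub>C ((1 / L) *\<^sub>R integral {a..a + L} (\<lambda>t. V \<beta> t f))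
      + (cnj \<xi> powi n) *\<^sub>C ((1 / L) *\<^sub>R integral {a..a + L} (\<lambda>t. V (n * \<beta>) t fn))"
  proof -
    have C: "integral {a..a + L} (\<lambda>t. b *\<^sub>C V \<gamma> t x) = b *\<^sub>C integral {a..a + L} (\<lambda>t. V \<gamma> t x)" for b \<gamma> x
      using integral_linear[OF integrable_V[OF a(1), of \<gamma> x "a + L"] bounded_linear_scaleC[of b]] by (simp add: o_def)
    have "integral {a..a + L} u = (K - 1) *\<^sub>R integral {a..a + L} (\<lambda>t. U t h)
       - (of_real K * cnj \<xi>) *\<^sub>C integral {a..a + L} (\<lambda>t. V \<beta> t f)
       + (cnj \<xi> powi n) *\<^sub>C integral {a..a + L} (\<lambda>t. V (n * \<beta>) t fn)"
      unfolding u_def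
      by (simp only: integral_add[OF integrable_diff[OF intU int] int] integral_diff[OF intU int] C integral_cmul)
    then show ?thesis
      by (simp only: avg_def scaleC_scaleR scaleR_right_distrib scaleR_diff_right scaleR_left_commute)
  qed
  ultimately show ?thesis using a(2) by (simp add: h_def f_def fn_def)
qed

text \<open>Under the integral \<open>ft\<close> is first replaced by \<open>f\<close>, then the
  rotated orbit of \<open>f\<close> by \<open>f\<close> itself; the second cost grows with the end
  \<open>a + L\<close> of the window.\<close>

lemma norm_avg_V_diff_le:
  assumes gen: "generates f g" and a: "0 \<le> a" "0 < L"
  shows "norm ((1 / L) *\<^sub>R integral {a..a + L} (\<lambda>t. V \<beta> t ft) - f)
    \<le> M * norm (ft - f) + (a + L) * (M * norm (g - (\<i> * of_real \<beta>) *\<^sub>C f))"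
proof -
  define B where "B = M * norm (ft - f) + (a + L) * (M * norm (g - (\<i> * of_real \<beta>) *\<^sub>C f))"
  have B: "norm (integral {a..a + L} (\<lambda>t. V \<beta> t ft - f)) \<le> B * (a + L - a)"
  proof (rule integral_bound)
    show "continuous_on {a..a + L} (\<lambda>t. V \<beta> t ft - f)"
      using a by (intro continuous_on_diff continuous_on_subset[OF continuous_on_V] continuous_on_const) auto
    fix t assume t: "t \<in> {a..a + L}"
    then have t0: "0 \<le> t" using a by simp
    have "V \<beta> t ft - f = V \<beta> t (ft - f) + (V \<beta> t f - f)"
      by (simp add: linear_diff[OF linear[OF t0]] scaleC_diff_right)
    also have "norm \<dots> \<le> norm (V \<beta> t (ft - f)) + norm (V \<beta> t f - f)"
      by (rule norm_triangle_ineq)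
    also have "\<dots> \<le> B"
      unfolding B_def
    proof (rule add_mono[OF norm_V_le[OF t0]])
      have "norm (V \<beta> t f - f) \<le> t * (M * norm (g - (\<i> * of_real \<beta>) *\<^sub>C f))"
        by (rule norm_V_diff_le[OF gen t0])
      also have "\<dots> \<le> (a + L) * (M * norm (g - (\<i> * of_real \<beta>) *\<^sub>C f))"
        using t M by (intro mult_right_mono) auto
      finally show "norm (V \<beta> t f - f) \<le> (a + L) * (M * norm (g - (\<i> * of_real \<beta>) *\<^sub>C f))" .
    qed
    finally show "norm (V \<beta> t ft - f) \<le> B" .
  qed (use a in auto)
  have "integral {a..a + L} (\<lambda>t. V \<beta> t ft - f) = integral {a..a + L} (\<lambda>t. V \<beta> t ft) - L *\<^sub>R f"
    using a by (subst integral_diff[OF integrable_V]) (auto simp: integrable_const_ivl)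
  moreover have "(1 / L) *\<^sub>R x - f = (1 / L) *\<^sub>R (x - L *\<^sub>R f)" for x
    using a by (simp add: scaleR_diff_right)
  ultimately have "norm ((1 / L) *\<^sub>R integral {a..a + L} (\<lambda>t. V \<beta> t ft) - f)
      = (1 / L) * norm (integral {a..a + L} (\<lambda>t. V \<beta> t ft - f))"
    using a by simp
  also have "\<dots> \<le> (1 / L) * (B * (a + L - a))"
    using B a by (intro mult_left_mono) auto
  finally show ?thesis using a by (simp add: B_def)
qed

text \<open>Contradicts the conclusion of \<open>rneg_avg_gt\<close> for
  \<open>q = (K - 1) / K\<close>; the hypothesis on \<open>C\<close> stands for i n \<beta> being in
  the resolvent set. The order of choices matters: first \<eta> and the net, then \<epsilon>, which
  depends on the size of the net and fixes the window, then \<kappa>, which depends on the window,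
  and the approximate eigenvector \<open>f\<close> last.\<close>

lemma exists_rneg_avg_le:
  fixes n :: int and K \<tau> \<beta> :: real
  assumes pos: "\<And>\<epsilon>. 0 < \<epsilon> \<Longrightarrow> \<exists>a\<ge>0. \<forall>t p. a \<le> t \<longrightarrow> 0 \<le> p \<longrightarrow> defect (U t (Cx p 0)) \<le> \<epsilon> * norm p"
    and approx: "\<And>\<kappa>. 0 < \<kappa> \<Longrightarrow> \<exists>f g. generates f g \<and> norm f = 1 \<and> norm (g - (\<i> * of_real \<beta>) *\<^sub>C f) < \<kappa>"
    and C: "0 \<le> C" "\<And>f a b. 0 \<le> a \<Longrightarrow> a \<le> b \<Longrightarrow> norm (integral {a..b} (\<lambda>t. V (n * \<beta>) t f)) \<le> C * norm f"
    and K: "K = (real_of_int n)\<^sup>2 + 1" and \<tau>: "0 < \<tau>"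
  shows "\<exists>h a L. 0 \<le> h \<and> norm h = 1 \<and> 0 \<le> a \<and> 0 < L \<and>
    (\<forall>t p. a \<le> t \<longrightarrow> 0 \<le> p \<longrightarrow> defect (U t (Cx p 0)) \<le> \<tau> * norm p) \<and>
    rneg (((K - 1) / K) *\<^sub>R avg a L (Cx h 0) - Cx h 0) \<le> \<tau>"
proof -
  have K1: "1 \<le> K" by (simp add: K)
  have KM: "1 \<le> K * M" using mult_mono[OF K1 M] K1 by simp
  have cancel: "x * (\<tau> / (8 * x)) = \<tau> / 8" if "1 \<le> x" for x using that by simp
  define \<eta> where "\<eta> = min 1 (\<tau> / (8 * (K * M)))"
  have \<eta>: "0 < \<eta>" "\<eta> \<le> 1" "K * M * \<eta> \<le> \<tau> / 8"
  proof -
    have "K * M * \<eta> \<le> K * M * (\<tau> / (8 * (K * M)))" using KM by (intro mult_left_mono) (auto simp: \<eta>_def)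
    also have "\<dots> = \<tau> / 8" using cancel[OF KM] .
    finally show "K * M * \<eta> \<le> \<tau> / 8" .
  qed (use \<tau> KM in \<open>auto simp: \<eta>_def\<close>)
  have "0 < \<eta>\<^sup>2 / 4" using \<eta> by simp
  then obtain Z :: "complex set" where Z: "finite Z" "\<And>\<zeta>. \<zeta> \<in> Z \<Longrightarrow> cmod \<zeta> = 1"
    "\<And>\<xi>. cmod \<xi> = 1 \<Longrightarrow> \<exists>\<zeta>\<in>Z. cmod (\<xi> - \<zeta>) \<le> \<eta>\<^sup>2 / 4"
    using unit_circle_net by metis
  define N where "N = real (card Z) + 1"
  have N: "1 \<le> N" "real (card Z) \<le> N" by (simp_all add: N_def)
  \<comment> \<open>A window of this length brings the bound \<open>C\<close> on the integral down
    to an average of at most \<tau> / 8.\<close>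
  define L where "L = 8 * C / \<tau> + 1"
  have L: "0 < L" "C / L \<le> \<tau> / 8"
    using C(1) \<tau> by (auto simp: L_def add_nonneg_pos field_simps)
  \<comment> \<open>\<open>N\<close> enters twice: the error for a single \<xi> is already
    proportional to the size of the net, and these errors are then summed over the net.\<close>
  define \<epsilon> where "\<epsilon> = \<tau> / (16 * K * N * N)"
  have \<epsilon>: "0 < \<epsilon>" "\<epsilon> \<le> \<tau>" "N * (N * (2 * K * \<epsilon>)) \<le> \<tau> / 8"
  proof -
    have "1 * 1 * 1 \<le> 16 * K * N * N" using K1 N by (intro mult_mono) auto
    then show "\<epsilon> \<le> \<tau>" using \<tau> unfolding \<epsilon>_def by (simp add: divide_le_eq_1 pos_divide_le_eq)
  qed (use \<tau> K1 N in \<open>auto simp: \<epsilon>_def\<close>)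
  obtain a where a: "0 \<le> a"
    and pos_a: "\<And>t p. a \<le> t \<Longrightarrow> 0 \<le> p \<Longrightarrow> defect (U t (Cx p 0)) \<le> \<epsilon> * norm p"
    using pos[OF \<epsilon>(1)] by blast
  define \<kappa> where "\<kappa> = \<tau> / (8 * (K * M) * (a + L))"
  have \<kappa>: "0 < \<kappa>" "K * ((a + L) * (M * \<kappa>)) = \<tau> / 8" using \<tau> KM a L K1 M by (auto simp: \<kappa>_def)
  obtain f g where gen: "generates f g" and f: "norm f = 1"
    and fg: "norm (g - (\<i> * of_real \<beta>) *\<^sub>C f) < \<kappa>"
    using approx[OF \<kappa>(1)] by blast
  define h where "h = modulus f"
  have h: "0 \<le> h" "norm h = 1" by (simp_all add: h_def norm_modulus f)
  obtain w where "\<And>\<zeta>. \<zeta> \<in> Z \<Longrightarrow> 0 \<le> w \<zeta>" "(\<Sum>\<zeta>\<in>Z. w \<zeta>) = modulus f"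
    "modulus (f - (\<Sum>\<zeta>\<in>Z. \<zeta> *\<^sub>C Cx (w \<zeta>) 0)) \<le> \<eta> *\<^sub>R modulus f"
    by (rule simple_approximation[OF \<eta>(1,2) Z, of f]) (assumption | rule that)+
  note w = this[folded h_def]
  define ft where "ft = (\<Sum>\<zeta>\<in>Z. \<zeta> *\<^sub>C Cx (w \<zeta>) 0)"
  define fn where "fn = (\<Sum>\<zeta>\<in>Z. (\<zeta> powi n) *\<^sub>C Cx (w \<zeta>) 0)"
  have ft: "norm (ft - f) \<le> \<eta>"
  proof -
    have "norm (f - ft) \<le> norm (\<eta> *\<^sub>R h)"
      using norm_mono_nonneg[OF modulus_nonneg w(3)] by (simp only: norm_modulus ft_def)
    then show ?thesis using \<eta> h by (simp add: norm_minus_commute)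
  qed
  \<comment> \<open>The coefficients stay unimodular when raised to the power \<open>n\<close>, so
    the modulus is still at most the sum \<open>h\<close> of the weights.\<close>
  have fn: "norm fn \<le> 1"
  proof -
    have "modulus fn \<le> (\<Sum>\<zeta>\<in>Z. modulus ((\<zeta> powi n) *\<^sub>C Cx (w \<zeta>) 0))"
      unfolding fn_def by (rule modulus_sum_le)
    also have "\<dots> = (\<Sum>\<zeta>\<in>Z. w \<zeta>)"
      using Z(2) w(1) by (intro sum.cong) (auto simp: modulus_scaleC norm_power_int)
    finally have "modulus fn \<le> h" by (simp only: w(2))
    then show ?thesis using h(2) norm_mono_nonneg[OF modulus_nonneg] norm_modulus by metis
  qed
  have hsum: "(\<Sum>\<zeta>\<in>Z. Cx (w \<zeta>) 0) = Cx h 0"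
  proof -
    have "(\<Sum>\<zeta>\<in>Y. Cx (w \<zeta>) 0) = Cx (\<Sum>\<zeta>\<in>Y. w \<zeta>) 0" for Y
      by (induction Y rule: infinite_finite_induct)
        (simp_all add: zero_complexification_def plus_complexification_def)
    then show ?thesis by (simp only: w(2))
  qed
  have norm_w: "norm (w \<zeta>) \<le> 1" if "\<zeta> \<in> Z" for \<zeta>
  proof -
    have "w \<zeta> \<le> h" unfolding w(2)[symmetric] using sum_mono2[OF Z(1), of "{\<zeta>}" w] that w(1) by simp
    then show ?thesis using norm_mono_nonneg[OF w(1)[OF that]] h(2) by metis
  qed
  define H where "H = avg a L (Cx h 0)"
  define F where "F = (1 / L) *\<^sub>R integral {a..a + L} (\<lambda>t. V \<beta> t ft)"
  define G where "G = (1 / L) *\<^sub>R integral {a..a + L} (\<lambda>t. V (n * \<beta>) t fn)"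
  define Y where "Y \<xi> = (K - 1) *\<^sub>R H - (of_real K * cnj \<xi>) *\<^sub>C F + (cnj \<xi> powi n) *\<^sub>C G" for \<xi>
  have Y: "rneg (Y \<xi>) \<le> N * (2 * K * \<epsilon>)" if "\<xi> \<in> Z" for \<xi>
  proof -
    have "rneg (Y \<xi>) \<le> card Z * (2 * K * \<epsilon>)"
      unfolding Y_def H_def F_def G_def ft_def fn_def hsum[symmetric]
    proof (rule rneg_rotated_le[OF Z(1,2) Z(2)[OF that] K a L(1)])
      fix t \<zeta> assume t: "a \<le> t" and \<zeta>: "\<zeta> \<in> Z"
      have "defect (U t (Cx (w \<zeta>) 0)) \<le> \<epsilon> * norm (w \<zeta>)" by (rule pos_a[OF t w(1)[OF \<zeta>]])
      also have "\<dots> \<le> \<epsilon> * 1" using norm_w[OF \<zeta>] \<epsilon> by (intro mult_left_mono) auto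
      finally show "defect (U t (Cx (w \<zeta>) 0)) \<le> \<epsilon>" by simp
    qed
    also have "\<dots> \<le> N * (2 * K * \<epsilon>)" using N K1 \<epsilon> by (intro mult_right_mono) auto
    finally show ?thesis .
  qed
  have F: "K * norm (F - f) \<le> \<tau> / 4"
  proof -
    have "norm (F - f) \<le> M * norm (ft - f) + (a + L) * (M * norm (g - (\<i> * of_real \<beta>) *\<^sub>C f))"
      unfolding F_def by (rule norm_avg_V_diff_le[OF gen a L(1)])
    also have "\<dots> \<le> M * \<eta> + (a + L) * (M * \<kappa>)"
      using ft fg M a L by (intro add_mono mult_left_mono) auto
    finally have "K * norm (F - f) \<le> K * (M * \<eta> + (a + L) * (M * \<kappa>))"
      using K1 by (intro mult_left_mono) auto
    also have "\<dots> = K * M * \<eta> + K * ((a + L) * (M * \<kappa>))" by (simp add: algebra_simps)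
    finally show ?thesis using \<eta>(3) \<kappa>(2) by simp
  qed
  have G: "norm G \<le> \<tau> / 8"
  proof -
    have "norm (integral {a..a + L} (\<lambda>t. V (n * \<beta>) t fn)) \<le> C * norm fn"
      using a L by (intro C(2)) auto
    also have "\<dots> \<le> C * 1" using fn C(1) by (intro mult_left_mono)
    finally have "norm G \<le> C / L" using L(1) by (simp add: G_def divide_right_mono)
    then show ?thesis using L(2) by (rule order_trans)
  qed
  \<comment> \<open>Summing the negative parts over the net makes \<open>e\<close> independent of
    \<xi>, so that one upper bound serves all directions when the modulus is recovered.\<close>
  define e where "e = K *\<^sub>R modulus (f - F) + modulus G + (\<Sum>\<xi>\<in>Z. pprt (- real_part (Y \<xi>)))"
  have e0: "0 \<le> e" unfolding e_def using K1
    by (intro add_nonneg_nonneg sum_nonneg scaleR_nonneg_nonneg) auto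
  have e: "norm e \<le> \<tau> / 2"
  proof -
    have "norm e \<le> K * norm (f - F) + norm G + (\<Sum>\<xi>\<in>Z. rneg (Y \<xi>))"
      unfolding e_def rneg_def using K1 norm_sum[of "\<lambda>\<xi>. pprt (- real_part (Y \<xi>))" Z]
      by (intro order_trans[OF norm_triangle_ineq] add_mono) (auto simp: norm_modulus)
    also have "(\<Sum>\<xi>\<in>Z. rneg (Y \<xi>)) \<le> card Z * (N * (2 * K * \<epsilon>))"
      using Y by (rule sum_bounded_above)
    also have "\<dots> \<le> N * (N * (2 * K * \<epsilon>))" using N K1 \<epsilon> by (intro mult_right_mono) auto
    finally show ?thesis using F G \<epsilon>(3) by (simp add: norm_minus_commute)
  qed
  have "K *\<^sub>R real_part (cnj \<xi> *\<^sub>C f) \<le> (K - 1) *\<^sub>R real_part H + e" if \<xi>: "\<xi> \<in> Z" for \<xi>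
  proof -
    have "- pprt (- real_part (Y \<xi>)) \<le> real_part (Y \<xi>)"
      using le_pprt[of "- real_part (Y \<xi>)"] by (simp add: minus_le_iff)
    moreover have "pprt (- real_part (Y \<xi>)) \<le> (\<Sum>\<xi>\<in>Z. pprt (- real_part (Y \<xi>)))"
      using sum_mono2[OF Z(1), of "{\<xi>}" "\<lambda>\<xi>. pprt (- real_part (Y \<xi>))"] \<xi> by simp
    moreover have "real_part ((of_real K * cnj \<xi>) *\<^sub>C (f - F)) \<le> K *\<^sub>R modulus (f - F)"
      using real_part_scaleC_le_modulus[of "of_real K * cnj \<xi>" "f - F"] Z(2)[OF \<xi>] K1
      by (simp only: norm_mult norm_of_real complex_mod_cnj) simp
    moreover have "real_part ((cnj \<xi> powi n) *\<^sub>C G) \<le> modulus G"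
      using Z(2)[OF \<xi>] by (intro real_part_unit_le_modulus) (simp add: norm_power_int)
    moreover have "K *\<^sub>R real_part (cnj \<xi> *\<^sub>C f)
        = (K - 1) *\<^sub>R real_part H - real_part (Y \<xi>) + real_part ((of_real K * cnj \<xi>) *\<^sub>C (f - F)) + real_part ((cnj \<xi> powi n) *\<^sub>C G)"
    proof -
      have "K *\<^sub>R real_part (cnj \<xi> *\<^sub>C f) = real_part ((of_real K * cnj \<xi>) *\<^sub>C f)"
        by (simp only: complexification_parts_scaleR[symmetric] scaleC_of_real[symmetric] scaleC_scaleC)
      moreover have "real_part (Y \<xi>) = (K - 1) *\<^sub>R real_part H - real_part ((of_real K * cnj \<xi>) *\<^sub>C F) + real_part ((cnj \<xi> powi n) *\<^sub>C G)"
        by (simp only: Y_def complexification_parts complexification_parts_scaleR)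
      moreover have "real_part ((of_real K * cnj \<xi>) *\<^sub>C (f - F)) = real_part ((of_real K * cnj \<xi>) *\<^sub>C f) - real_part ((of_real K * cnj \<xi>) *\<^sub>C F)"
        by (simp only: scaleC_diff_right complexification_parts)
      ultimately show ?thesis by (simp only:) simp
    qed
    moreover have "x - y + u + v \<le> x + (u' + v' + s)"
      if "- p \<le> y" "p \<le> s" "u \<le> u'" "v \<le> v'" for x y u v u' v' p s :: 'a
      using add_mono[OF add_mono[OF that(3,4)] order_trans[OF iffD1[OF minus_le_iff that(1)] that(2)]]
      by (simp add: algebra_simps)
    ultimately show ?thesis unfolding e_def by (simp only:)
  qed
  note le = this
  define E where "E = (1 / K) *\<^sub>R e + (\<eta>\<^sup>2 / 4) *\<^sub>R h"
  \<comment> \<open>Division by \<open>K\<close> produces the contraction factor; the term with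
    \<eta>^2 / 4 is the price of testing only the directions of the net.\<close>
  have "h \<le> (((K - 1) / K) *\<^sub>R real_part H + (1 / K) *\<^sub>R e) + (\<eta>\<^sup>2 / 4) *\<^sub>R h"
    unfolding h_def
  proof (rule modulus_le_net[OF Z(3)])
    fix \<xi> assume "\<xi> \<in> Z"
    from scaleR_left_mono[OF le[OF this], of "1 / K"]
    show "real_part (cnj \<xi> *\<^sub>C f) \<le> ((K - 1) / K) *\<^sub>R real_part H + (1 / K) *\<^sub>R e"
      using K1 by (simp add: scaleR_right_distrib)
  qed
  then have "h - ((K - 1) / K) *\<^sub>R real_part H \<le> E"
    by (simp add: E_def algebra_simps)
  then have "- real_part (((K - 1) / K) *\<^sub>R H - Cx h 0) \<le> E" by simp
  moreover have "0 \<le> E" unfolding E_def using e0 h K1 by (intro add_nonneg_nonneg scaleR_nonneg_nonneg) auto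
  ultimately have "rneg (((K - 1) / K) *\<^sub>R H - Cx h 0) \<le> norm E"
    unfolding rneg_def by (rule norm_pprt_le)
  also have "\<dots> \<le> norm e + \<eta>\<^sup>2 / 4"
  proof -
    have "norm ((1 / K) *\<^sub>R e) \<le> 1 * norm e"
      using K1 by (simp add: divide_le_eq mult_le_cancel_left1 mult_ge1_I)
    then show ?thesis unfolding E_def using h by (intro order_trans[OF norm_triangle_ineq] add_mono) auto
  qed
  also have "\<dots> \<le> \<tau> / 2 + \<tau> / 8"
  proof (rule add_mono[OF e])
    have "\<eta>\<^sup>2 \<le> \<eta>" using \<eta> by (simp add: power2_eq_square mult_left_le)
    moreover have "\<eta> \<le> K * M * \<eta>" using mult_right_mono[OF KM, of \<eta>] \<eta> by simp
    ultimately show "\<eta>\<^sup>2 / 4 \<le> \<tau> / 8" using \<eta>(3) \<tau> by linarith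
  qed
  also have "\<dots> \<le> \<tau>" using \<tau> by simp
  finally have "rneg (((K - 1) / K) *\<^sub>R avg a L (Cx h 0) - Cx h 0) \<le> \<tau>" by (simp only: H_def)
  moreover have "defect (U t (Cx p 0)) \<le> \<tau> * norm p" if "a \<le> t" "0 \<le> p" for t p
    using pos_a[OF that] mult_right_mono[OF \<epsilon>(2), of "norm p"] by simp
  ultimately show ?thesis using h a L by blast
qed

end

section \<open>Resolvent and approximate eigenvectors\<close>

locale linear_operator =
  fixes D :: "'a :: banach_lattice complexification set"
    and A :: "'a complexification \<Rightarrow> 'a complexification"
  assumes add: "f \<in> D \<Longrightarrow> g \<in> D \<Longrightarrow> f + g \<in> D \<and> A (f + g) = A f + A g"
    and scaleC: "f \<in> D \<Longrightarrow> c *\<^sub>C f \<in> D \<and> A (c *\<^sub>C f) = c *\<^sub>C A f"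
begin

lemma scaleR: "f \<in> D \<Longrightarrow> r *\<^sub>R f \<in> D \<and> A (r *\<^sub>R f) = r *\<^sub>R A f"
  using scaleC[of f "of_real r"] by simp

lemma diff: "f \<in> D \<Longrightarrow> g \<in> D \<Longrightarrow> f - g \<in> D \<and> A (f - g) = A f - A g"
  using add[of f "(- 1) *\<^sub>R g"] scaleR[of g "- 1"] by simp

text \<open>The lower bound gives injectivity and the bound 1 / \<kappa> for the inverse at
  once.\<close>

lemma resolvent_setI:
  assumes surj: "\<And>y. \<exists>f\<in>D. \<nu> *\<^sub>C f - A f = y"
    and below: "\<And>f. f \<in> D \<Longrightarrow> \<kappa> * norm f \<le> norm (\<nu> *\<^sub>C f - A f)" and \<kappa>: "0 < \<kappa>"
  shows "\<nu> \<in> resolvent_set (D, A)"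
proof -
  define B where "B f = \<nu> *\<^sub>C f - A f" for f
  have B_add: "B (f + g) = B f + B g" and B_diff: "B (f - g) = B f - B g"
    if "f \<in> D" "g \<in> D" for f g
    using add[OF that] diff[OF that] by (simp_all add: B_def scaleC_add_right scaleC_diff_right)
  have B_scaleR: "B (r *\<^sub>R f) = r *\<^sub>R B f" if "f \<in> D" for f r
    using scaleR[OF that] by (simp add: B_def scaleC_scaleR scaleR_diff_right)
  have inj: "inj_on B D"
  proof (rule inj_onI)
    fix f g assume fg: "f \<in> D" "g \<in> D" "B f = B g"
    then have "\<kappa> * norm (f - g) \<le> 0"
      using below[of "f - g"] diff[of f g] B_diff[of f g] by (simp add: B_def)
    then show "f = g" using \<kappa> by (simp add: mult_le_0_iff)
  qed
  have range: "y \<in> B ` D" for y using surj[of y] by (auto simp: B_def)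
  define S where "S = inv_into D B"
  have S: "S y \<in> D" "B (S y) = y" for y
    unfolding S_def by (rule inv_into_into[OF range], rule f_inv_into_f[OF range])
  have S_eq: "S (B f) = f" if "f \<in> D" for f
    unfolding S_def by (rule inv_into_f_f[OF inj that])
  have "bounded_linear S"
  proof (rule bounded_linear_intro)
    show "S (x + y) = S x + S y" for x y
      using S_eq[of "S x + S y"] add[OF S(1) S(1), of x y] by (simp add: B_add S)
    show "S (r *\<^sub>R x) = r *\<^sub>R S x" for r x
      using S_eq[of "r *\<^sub>R S x"] scaleR[OF S(1), of r x] by (simp add: B_scaleR S)
    show "norm (S y) \<le> norm y * (1 / \<kappa>)" for y
      using below[OF S(1), of y] S(2)[of y] \<kappa> by (simp add: B_def field_simps)
  qed
  moreover have "bij_betw B D UNIV" using inj range by (auto simp: bij_betw_def)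
  ultimately show ?thesis by (simp add: B_def[abs_def] S_def)
qed

lemma resolvent_setD:
  assumes "\<nu> \<in> resolvent_set (D, A)"
  obtains R where "bounded_linear R" "\<And>y. R y \<in> D" "\<And>y. \<nu> *\<^sub>C R y - A (R y) = y"
proof (rule that)
  let ?B = "\<lambda>f. \<nu> *\<^sub>C f - A f"
  have bij: "bij_betw ?B D UNIV" using assms by simp
  then have range: "y \<in> ?B ` D" for y by (auto simp: bij_betw_def)
  show "bounded_linear (inv_into D ?B)" using assms by simp
  show "inv_into D ?B y \<in> D" for y by (rule inv_into_into[OF range])
  show "\<nu> *\<^sub>C inv_into D ?B y - A (inv_into D ?B y) = y" for y
    by (rule f_inv_into_f[OF range])
qed

text \<open>The lower bound makes the resolvent \<open>R\<close> at \<mu> have norm at most 1 /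
  \<kappa>, so that x \<mapsto> y - (\<nu> - \<mu>) R x is a contraction. Its fixed point x yields
  the preimage R x of y.\<close>

lemma resolvent_set_perturb:
  assumes \<mu>: "\<mu> \<in> resolvent_set (D, A)"
    and below: "\<And>f. f \<in> D \<Longrightarrow> \<kappa> * norm f \<le> norm (\<mu> *\<^sub>C f - A f)" and less: "cmod (\<nu> - \<mu>) < \<kappa>"
  shows "\<nu> \<in> resolvent_set (D, A)"
proof -
  obtain R where R: "bounded_linear R" "\<And>y. R y \<in> D" "\<And>y. \<mu> *\<^sub>C R y - A (R y) = y"
    using resolvent_setD[OF \<mu>] by blast
  define d where "d = \<nu> - \<mu>"
  have \<kappa>: "0 < \<kappa>" using less norm_ge_zero[of "\<nu> - \<mu>"] by linarith
  have split: "\<nu> *\<^sub>C f - A f = (\<mu> *\<^sub>C f - A f) + d *\<^sub>C f" for f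
    by (rule complexification_eqI) (simp_all add: d_def algebra_simps)
  show ?thesis
  proof (rule resolvent_setI)
    fix y
    have lip: "dist (y - d *\<^sub>C R x) (y - d *\<^sub>C R x') \<le> (cmod d / \<kappa>) * dist x x'" for x x'
    proof -
      have "\<kappa> * norm (R (x - x')) \<le> norm (x - x')"
        using below[OF R(2)] R(3) by metis
      then have "cmod d * norm (R (x - x')) \<le> cmod d * (norm (x - x') / \<kappa>)"
        using \<kappa> by (intro mult_left_mono) (simp_all add: field_simps)
      moreover have "dist (y - d *\<^sub>C R x) (y - d *\<^sub>C R x') = norm (d *\<^sub>C R (x' - x))"
        using linear_diff[OF bounded_linear.linear[OF R(1)]]
        by (simp add: dist_norm scaleC_diff_right)
      moreover have "norm (R (x' - x)) = norm (R (x - x'))"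
        using linear_diff[OF bounded_linear.linear[OF R(1)]] by (simp add: norm_minus_commute)
      ultimately show ?thesis by (simp add: norm_scaleC dist_norm)
    qed
    have "cmod d / \<kappa> < 1" using less \<kappa> by (simp add: d_def)
    with banach_fix_type[of "cmod d / \<kappa>" "\<lambda>x. y - d *\<^sub>C R x"] lip \<kappa>
    obtain x where x: "y - d *\<^sub>C R x = x" by auto
    then have "\<nu> *\<^sub>C R x - A (R x) = y" unfolding split R(3) by (metis diff_add_cancel)
    then show "\<exists>f\<in>D. \<nu> *\<^sub>C f - A f = y" using R(2) by blast
  next
    fix f assume f: "f \<in> D"
    have "norm (\<mu> *\<^sub>C f - A f) \<le> norm (\<nu> *\<^sub>C f - A f) + norm (d *\<^sub>C f)"
      using norm_triangle_ineq4[of "\<nu> *\<^sub>C f - A f" "d *\<^sub>C f"] by (simp only: split) simp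
    with below[OF f] show "(\<kappa> - cmod d) * norm f \<le> norm (\<nu> *\<^sub>C f - A f)"
      by (simp add: norm_scaleC algebra_simps)
  qed (use less in \<open>simp add: d_def\<close>)
qed

text \<open>Otherwise \<nu> - A is bounded below by \<kappa>. At the point \<mu> lying \<kappa> / 3
  to the right, in the resolvent set, the lower bound is still 2 \<kappa> / 3, more than the
  distance to \<nu>, and perturbation puts \<nu> into the resolvent set.\<close>

lemma approximate_eigenvector:
  assumes \<nu>: "\<nu> \<notin> resolvent_set (D, A)" and right: "\<And>r. 0 < r \<Longrightarrow> \<nu> + of_real r \<in> resolvent_set (D, A)"
    and \<kappa>: "0 < \<kappa>"
  shows "\<exists>f\<in>D. norm f = 1 \<and> norm (A f - \<nu> *\<^sub>C f) < \<kappa>"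
proof (rule ccontr)
  assume neg: "\<not> ?thesis"
  have below: "\<kappa> * norm f \<le> norm (\<nu> *\<^sub>C f - A f)" if f: "f \<in> D" for f
  proof (cases "f = 0")
    case False
    define g where "g = (1 / norm f) *\<^sub>R f"
    have "g \<in> D" "A g = (1 / norm f) *\<^sub>R A f" using scaleR[OF f] by (auto simp: g_def)
    moreover have "norm g = 1" using False by (simp add: g_def)
    ultimately have "\<kappa> \<le> norm (A g - \<nu> *\<^sub>C g)" using neg by force
    also have "A g - \<nu> *\<^sub>C g = (1 / norm f) *\<^sub>R (A f - \<nu> *\<^sub>C f)"
      using \<open>A g = _\<close> by (simp add: g_def scaleC_scaleR scaleR_diff_right)
    also have "norm ((1 / norm f) *\<^sub>R (A f - \<nu> *\<^sub>C f)) = norm (A f - \<nu> *\<^sub>C f) / norm f" by simp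
    finally show ?thesis using False by (simp add: field_simps norm_minus_commute)
  qed simp
  define \<mu> where "\<mu> = \<nu> + of_real (\<kappa> / 3)"
  have "\<nu> \<in> resolvent_set (D, A)"
  proof (rule resolvent_set_perturb)
    show "\<mu> \<in> resolvent_set (D, A)" unfolding \<mu>_def using \<kappa> by (intro right) simp
    show "cmod (\<nu> - \<mu>) < 2 * \<kappa> / 3" using \<kappa> by (simp add: \<mu>_def)
    fix f assume f: "f \<in> D"
    have "\<nu> *\<^sub>C f - A f = (\<mu> *\<^sub>C f - A f) - (\<kappa> / 3) *\<^sub>R f"
      by (rule complexification_eqI) (simp_all add: \<mu>_def algebra_simps)
    then have "norm (\<nu> *\<^sub>C f - A f) \<le> norm (\<mu> *\<^sub>C f - A f) + norm ((\<kappa> / 3) *\<^sub>R f)"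
      by (simp only: norm_triangle_ineq4)
    then have "norm (\<nu> *\<^sub>C f - A f) \<le> norm (\<mu> *\<^sub>C f - A f) + \<kappa> / 3 * norm f"
      using \<kappa> by simp
    with below[OF f] show "2 * \<kappa> / 3 * norm f \<le> norm (\<mu> *\<^sub>C f - A f)" by simp
  qed
  with \<nu> show False by simp
qed

end

section \<open>The generator and the rescaled semigroup\<close>

lemma linear_operator_generator:
  assumes "c0_semigroup T"
  shows "linear_operator (fst (generator T)) (snd (generator T))"
proof -
  let ?q = "\<lambda>f t. (T t f - f) /\<^sub>R t"
  have D: "(?q f \<longlongrightarrow> snd (generator T) f) (at_right 0)" if "f \<in> fst (generator T)" for f
    using that tendsto_Lim[OF trivial_limit_at_right_real] by (auto simp: generator_def)
  have I: "f \<in> fst (generator T) \<and> snd (generator T) f = g" if "(?q f \<longlongrightarrow> g) (at_right 0)" for f g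
    using that tendsto_Lim[OF trivial_limit_at_right_real that] by (auto simp: generator_def)
  have T: "linear (T t)" "T t (c *\<^sub>C f) = c *\<^sub>C T t f" if "0 < t" for t c f
    using assms that by (auto simp: c0_semigroup_def bounded_linear.linear)
  show ?thesis
  proof
    fix f g assume "f \<in> fst (generator T)" "g \<in> fst (generator T)"
    then have "((\<lambda>t. ?q f t + ?q g t) \<longlongrightarrow> snd (generator T) f + snd (generator T) g) (at_right 0)"
      by (intro tendsto_add D)
    moreover have "\<forall>\<^sub>F t in at_right 0. ?q f t + ?q g t = ?q (f + g) t"
      using eventually_at_right_less[of "0 :: real"]
      by eventually_elim (simp add: linear_add[OF T(1)] algebra_simps)
    ultimately have "(?q (f + g) \<longlongrightarrow> snd (generator T) f + snd (generator T) g) (at_right 0)"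
      by (rule Lim_transform_eventually)
    then show "f + g \<in> fst (generator T) \<and> snd (generator T) (f + g) = snd (generator T) f + snd (generator T) g"
      by (rule I)
  next
    fix f c assume "f \<in> fst (generator T)"
    then have "((\<lambda>t. c *\<^sub>C ?q f t) \<longlongrightarrow> c *\<^sub>C snd (generator T) f) (at_right 0)"
      by (intro bounded_linear.tendsto[OF bounded_linear_scaleC] D)
    moreover have "\<forall>\<^sub>F t in at_right 0. c *\<^sub>C ?q f t = ?q (c *\<^sub>C f) t"
      using eventually_at_right_less[of "0 :: real"]
      by eventually_elim (simp add: T(2) scaleC_scaleR scaleC_diff_right)
    ultimately have "(?q (c *\<^sub>C f) \<longlongrightarrow> c *\<^sub>C snd (generator T) f) (at_right 0)"
      by (rule Lim_transform_eventually)
    then show "c *\<^sub>C f \<in> fst (generator T) \<and> snd (generator T) (c *\<^sub>C f) = c *\<^sub>C snd (generator T) f"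
      by (rule I)
  qed
qed

text \<open>As in the product rule, the quotient splits into the exponential times the original
  quotient and the difference quotient of the exponential times \<open>f\<close>.\<close>

lemma tendsto_rescaled_generator:
  assumes "c0_semigroup T" "f \<in> fst (generator T)"
  shows "((\<lambda>t. (rescaled s T t f - f) /\<^sub>R t) \<longlongrightarrow> snd (generator T) f - s *\<^sub>R f) (at_right 0)"
proof -
  have gen: "((\<lambda>t. (T t f - f) /\<^sub>R t) \<longlongrightarrow> snd (generator T) f) (at_right 0)"
    using assms(2) tendsto_Lim[OF trivial_limit_at_right_real] by (auto simp: generator_def)
  have "((\<lambda>t. exp (- (t * s))) has_real_derivative - s) (at 0)"
    by (auto intro!: derivative_eq_intros)
  then have "((\<lambda>t. (exp (- (t * s)) - 1) / t) \<longlongrightarrow> - s) (at 0)"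
    by (simp add: has_field_derivative_iff)
  then have e: "((\<lambda>t. (exp (- (t * s)) - 1) / t) \<longlongrightarrow> - s) (at_right 0)"
    by (rule filterlim_mono) (auto simp: at_le)
  have "((\<lambda>t. exp (- (t * s)) *\<^sub>R ((T t f - f) /\<^sub>R t) + ((exp (- (t * s)) - 1) / t) *\<^sub>R f)
      \<longlongrightarrow> exp (- (0 * s)) *\<^sub>R snd (generator T) f + (- s) *\<^sub>R f) (at_right 0)"
    by (intro tendsto_intros gen e)
  moreover have "exp (- (t * s)) *\<^sub>R ((T t f - f) /\<^sub>R t) + ((exp (- (t * s)) - 1) / t) *\<^sub>R f
      = (rescaled s T t f - f) /\<^sub>R t" for t
    by (simp add: rescaled_def divide_inverse algebra_simps)
  ultimately show ?thesis by simp
qed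

lemma bounded_c0_semigroup_rescaled:
  fixes T :: "real \<Rightarrow> 'a :: banach_lattice complexification \<Rightarrow> 'a complexification"
  assumes T: "c0_semigroup T" and bound: "bounded_semigroup (rescaled s T)"
  obtains M where "bounded_c0_semigroup (rescaled s T) M"
proof -
  obtain M where M: "\<And>t f. 0 \<le> t \<Longrightarrow> norm (rescaled s T t f) \<le> M * norm f"
    using bound by (auto simp: bounded_semigroup_def)
  have "bounded_c0_semigroup (rescaled s T) (max M 1)"
  proof (rule bounded_c0_semigroup.intro)
    fix t :: real assume t: "0 \<le> t"
    then have lin: "bounded_linear (T t)" "\<And>c f. T t (c *\<^sub>C f) = c *\<^sub>C T t f"
      using T by (auto simp: c0_semigroup_def)
    show "bounded_linear (rescaled s T t)"
      unfolding rescaled_def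
      by (rule bounded_linear_compose[OF bounded_linear_scaleR_right lin(1)])
    show "rescaled s T t (c *\<^sub>C f) = c *\<^sub>C rescaled s T t f" for c f
      by (simp add: rescaled_def lin(2) scaleC_scaleR)
    show "norm (rescaled s T t f) \<le> max M 1 * norm f" for f
      using M[OF t, of f] mult_right_mono[of M "max M 1" "norm f"] by simp
    fix r :: real and f :: "'a complexification" assume r: "0 \<le> r"
    have "T (r + t) f = T r (T t f)" using T r t by (simp add: c0_semigroup_def)
    moreover have "linear (T r)" using T r by (simp add: c0_semigroup_def bounded_linear.linear)
    ultimately show "rescaled s T (r + t) f = rescaled s T r (rescaled s T t f)"
      by (simp add: rescaled_def linear_scale distrib_right exp_add[symmetric])
  next
    fix f :: "'a complexification"
    show "rescaled s T 0 f = f" using T by (simp add: c0_semigroup_def rescaled_def)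
    have "((\<lambda>t. exp (- (t * s)) *\<^sub>R T t f) \<longlongrightarrow> exp (- (0 * s)) *\<^sub>R f) (at_right 0)"
      using T by (intro tendsto_intros) (simp add: c0_semigroup_def)
    then show "((\<lambda>t. rescaled s T t f) \<longlongrightarrow> f) (at_right 0)" by (simp add: rescaled_def)
  qed simp
  then show thesis by (rule that)
qed

section \<open>Cyclicity of the peripheral spectrum\<close>

theorem theorem4p7:
  fixes T :: "real \<Rightarrow> 'a :: banach_lattice complexification \<Rightarrow> 'a complexification"
  assumes "c0_semigroup T"
    and "uniformly_asymptotically_positive T"
  shows "let A = generator T; s = complex_of_real (real_of_ereal (spectral_bound A)) in
    \<forall>\<beta>::real. s + \<i> * of_real \<beta> \<in> spectrum A \<longrightarrow>
      (\<forall>n::int. s + \<i> * of_int n * of_real \<beta> \<in> spectrum A)"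
proof -
  obtain s where s: "spectral_bound (generator T) = ereal s"
    and bounded: "bounded_semigroup (rescaled s T)"
    and uap: "\<And>\<epsilon>. 0 < \<epsilon> \<Longrightarrow> \<exists>a\<ge>0. \<forall>t\<ge>a. \<forall>f\<in>positive_cone.
        infdist (rescaled s T t f) positive_cone \<le> \<epsilon> * norm f"
    using assms(2) unfolding uniformly_asymptotically_positive_def by blast
  obtain M where "bounded_c0_semigroup (rescaled s T) M"
    using bounded_c0_semigroup_rescaled[OF assms(1) bounded] .
  then interpret bounded_c0_semigroup "rescaled s T" M .
  define D where "D = fst (generator T)"
  define A where "A = snd (generator T)"
  have gen_eq: "generator T = (D, A)" by (simp add: D_def A_def)
  interpret gen: linear_operator D A
    unfolding D_def A_def by (rule linear_operator_generator[OF assms(1)])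
  have generates: "generates f (A f - s *\<^sub>R f)" if "f \<in> D" for f
    unfolding generates_def using tendsto_rescaled_generator[OF assms(1)] that by (simp add: D_def A_def)
  have right: "\<nu> \<in> resolvent_set (D, A)" if "s < Re \<nu>" for \<nu>
  proof (rule ccontr)
    assume "\<nu> \<notin> resolvent_set (D, A)"
    then have "ereal (Re \<nu>) \<le> spectral_bound (generator T)"
      unfolding spectral_bound_def gen_eq by (intro SUP_upper) (simp add: spectrum_def)
    with that show False by (simp add: s)
  qed
  have pos: "\<exists>a\<ge>0. \<forall>t p. a \<le> t \<longrightarrow> 0 \<le> p \<longrightarrow> defect (rescaled s T t (Cx p 0)) \<le> \<epsilon> * norm p"
    if \<epsilon>: "0 < \<epsilon>" for \<epsilon>
  proof -
    \<comment> \<open>Halving \<epsilon> compensates the factor 2 between \<open>defect\<close> and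
      the distance from the cone.\<close>
    obtain a where a: "0 \<le> a" "\<And>t f. a \<le> t \<Longrightarrow> f \<in> positive_cone \<Longrightarrow>
        infdist (rescaled s T t f) positive_cone \<le> \<epsilon> / 2 * norm f"
      using uap[of "\<epsilon> / 2"] half_gt_zero[OF \<epsilon>] by blast
    have "defect (rescaled s T t (Cx p 0)) \<le> \<epsilon> * norm p" if "a \<le> t" "0 \<le> p" for t p
    proof -
      have "Cx p 0 \<in> positive_cone" using that(2) by (auto simp: positive_cone_def)
      from a(2)[OF that(1) this] show ?thesis
        using defect_le_infdist[of "rescaled s T t (Cx p 0)"] by simp
    qed
    with a(1) show ?thesis by blast
  qed
  have "s + \<i> * of_int n * of_real \<beta> \<in> spectrum (D, A)"
    if \<beta>: "s + \<i> * of_real \<beta> \<in> spectrum (D, A)" for \<beta> :: real and n :: int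
  proof (rule ccontr)
    assume "\<not> ?thesis"
    then have "s + \<i> * of_int n * of_real \<beta> \<in> resolvent_set (D, A)" by (simp add: spectrum_def)
    then obtain R where R: "bounded_linear R" "\<And>y. R y \<in> D"
      "\<And>y. (s + \<i> * of_int n * of_real \<beta>) *\<^sub>C R y - A (R y) = y"
      using gen.resolvent_setD by blast
    obtain B where B: "\<And>y. norm (R y) \<le> norm y * B" "0 \<le> B"
      using bounded_linear.nonneg_bounded[OF R(1)] by blast
    define K where "K = (real_of_int n)\<^sup>2 + 1"
    have K: "1 \<le> K" by (simp add: K_def)
    have "0 \<le> (K - 1) / K" "(K - 1) / K < 1" using K by simp_all
    from rneg_avg_gt[OF this] obtain \<tau> where \<tau>: "0 < \<tau>"
      and gt: "\<And>h a L. 0 \<le> h \<Longrightarrow> norm h = 1 \<Longrightarrow> 0 \<le> a \<Longrightarrow> 0 < L \<Longrightarrow>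
        (\<forall>t p. a \<le> t \<longrightarrow> 0 \<le> p \<longrightarrow> defect (rescaled s T t (Cx p 0)) \<le> \<tau> * norm p) \<Longrightarrow>
        \<tau> < rneg (((K - 1) / K) *\<^sub>R avg a L (Cx h 0) - Cx h 0)"
      by blast
    have approx: "\<exists>f g. generates f g \<and> norm f = 1 \<and> norm (g - (\<i> * of_real \<beta>) *\<^sub>C f) < \<kappa>"
      if "0 < \<kappa>" for \<kappa>
    proof -
      have "\<exists>f\<in>D. norm f = 1 \<and> norm (A f - (s + \<i> * of_real \<beta>) *\<^sub>C f) < \<kappa>"
        using \<beta> that by (intro gen.approximate_eigenvector right) (auto simp: spectrum_def)
      then obtain f where f: "f \<in> D" "norm f = 1" "norm (A f - (s + \<i> * of_real \<beta>) *\<^sub>C f) < \<kappa>"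
        by blast
      moreover have "A f - (s + \<i> * of_real \<beta>) *\<^sub>C f = (A f - s *\<^sub>R f) - (\<i> * of_real \<beta>) *\<^sub>C f"
        by (rule complexification_eqI) (simp_all add: algebra_simps)
      ultimately show ?thesis using generates[OF f(1)] by metis
    qed
    \<comment> \<open>The resolvent writes \<open>f\<close> as i n \<beta> - (A - s) applied to
      \<open>R f\<close>, so the integrals of its rotated orbit are bounded uniformly in the
      interval.\<close>
    have int: "norm (integral {a..b} (\<lambda>t. V (n * \<beta>) t f)) \<le> (2 * M * B) * norm f"
      if "0 \<le> a" "a \<le> b" for f a b
    proof -
      have "(\<i> * of_real (n * \<beta>)) *\<^sub>C R f - (A (R f) - s *\<^sub>R R f)
          = (s + \<i> * of_int n * of_real \<beta>) *\<^sub>C R f - A (R f)"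
        by (rule complexification_eqI) (simp_all add: algebra_simps)
      also have "\<dots> = f" by (rule R(3))
      finally have "norm (integral {a..b} (\<lambda>t. V (n * \<beta>) t f)) \<le> 2 * M * norm (R f)"
        using norm_integral_V_le[OF generates[OF R(2)] that, of "n * \<beta>" f] by (simp only:)
      also have "\<dots> \<le> 2 * M * (norm f * B)" using M by (intro mult_left_mono B) simp
      finally show ?thesis by (simp add: mult_ac)
    qed
    have "0 \<le> 2 * M * B" using M B by simp
    \<comment> \<open>For this \<tau> the construction yields exactly a triple \<open>h\<close>,
      \<open>a\<close>, \<open>L\<close> that \<open>gt\<close> excludes.\<close>
    from exists_rneg_avg_le[OF pos approx this int K_def \<tau>] gt show False
      by (meson not_le)
  qed
  then show ?thesis by (simp add: Let_def gen_eq[symmetric] s)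
qed

end
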